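(* Let $n\ge3$ and $g\in\mathbb{C}S_n$. Let $K_{31^{n-3}}\in\mathbb{C}S_n$ be the sum of all $3$-cycles in $S_n$, and let $\bar K_{31^{n-3}}g$ denote $\sum (j_3\ j_2\ j_1)\,g$, the sum over all ordered triples $(j_3,j_2,j_1)$ of pairwise distinct elements of $\{1,\dots,n\}$. Then \[ 3\,\Phi(K_{31^{n-3}}g)=\Phi(\bar K_{31^{n-3}}g)=3\,\Delta_3\,\Phi(g). \]
   Context: $\Phi:\mathbb{C}S_n\to\mathbb{C}[p_1,p_2,\dots]$ is linear with $\Phi(\sigma)=p_{\alpha_1}\cdots p_{\alpha_m}$ for $\sigma$ of cycle type $(\alpha_1,\dots,\alpha_m)$ (fixed points counted as $1$-cycles). Permutations compose as functions, and $(j_3\ j_2\ j_1)$ is the cycle $j_3\mapsto j_2\mapsto j_1\mapsto j_3$. The operator $\Delta_3$ on $\mathbb{C}[p_1,p_2,\dots]$ is \[ \Delta_3=\frac13\sum_{i_1,i_2,i_3\ge1}\Big(i_1i_2i_3\,p_{i_1+i_2+i_3}\frac{\partial^3}{\partial p_{i_1}\partial p_{i_2}\partial p_{i_3}}+i_1(i_2+i_3)p_{i_1+i_3}p_{i_2}\frac{\partial^2}{\partial p_{i_1}\partial p_{i_2+i_3}}+i_2(i_1+i_3)p_{i_1+i_2}p_{i_3}\frac{\partial^2}{\partial p_{i_2}\partial p_{i_1+i_3}} \] \[ +i_3(i_1+i_2)p_{i_3+i_2}p_{i_1}\frac{\partial^2}{\partial p_{i_3}\partial p_{i_1+i_2}}+(i_1+i_2+i_3)p_{i_1}p_{i_2}p_{i_3}\frac{\partial}{\partial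 p_{i_1+i_2+i_3}}+(i_1+i_2+i_3)p_{i_1+i_2+i_3}\frac{\partial}{\partial p_{i_1+i_2+i_3}}\Big). \] *)

theory Defs
  imports Complex_Main "HOL-Library.Poly_Mapping" "HOL-Combinatorics.Orbits" "HOL-Algebra.Sym_Groups"
begin

text \<open>
  Polynomials are elements of the monoid algebra over the exponent vectors \<^typ>\<open>nat \<Rightarrow>\<^sub>0 nat\<close>, with the
  product of \<^theory>\<open>HOL-Library.Poly_Mapping\<close>. The variable of index \<open>0\<close> is spare: neither \<open>Phi\<close> nor
  \<open>Delta3\<close> ever involves it, so everything happens in the subring \<open>\<complex>[p\<^sub>1, p\<^sub>2, \<dots>]\<close>.
\<close>

type_synonym cpoly = "(nat \<Rightarrow>\<^sub>0 nat) \<Rightarrow>\<^sub>0 complex"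

definition pvar :: "nat \<Rightarrow> cpoly" where
  "pvar i = Poly_Mapping.single (Poly_Mapping.single i 1) 1"

definition pconst :: "complex \<Rightarrow> cpoly" where
  "pconst c = Poly_Mapping.single 0 c"

text \<open>
  The formal partial derivative: \<open>c p\<^sup>m\<close> goes to \<open>c m\<^sub>i p\<^bsup>m - e\<^sub>i\<^esup>\<close>. The truncated subtraction is harmless,
  since the coefficient vanishes when \<open>m\<^sub>i = 0\<close>.
\<close>

definition pdiff :: "nat \<Rightarrow> cpoly \<Rightarrow> cpoly" where
  "pdiff i f = (\<Sum>m\<in>Poly_Mapping.keys f.
     Poly_Mapping.single (m - Poly_Mapping.single i 1)
       (Poly_Mapping.lookup f m * of_nat (Poly_Mapping.lookup m i)))"

definition Delta3_term :: "nat \<Rightarrow> nat \<Rightarrow> nat \<Rightarrow> cpoly \<Rightarrow> cpoly" where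
  "Delta3_term i1 i2 i3 f =
     of_nat (i1 * i2 * i3) * pvar (i1 + i2 + i3) * pdiff i1 (pdiff i2 (pdiff i3 f))
   + of_nat (i1 * (i2 + i3)) * pvar (i1 + i3) * pvar i2 * pdiff i1 (pdiff (i2 + i3) f)
   + of_nat (i2 * (i1 + i3)) * pvar (i1 + i2) * pvar i3 * pdiff i2 (pdiff (i1 + i3) f)
   + of_nat (i3 * (i1 + i2)) * pvar (i3 + i2) * pvar i1 * pdiff i3 (pdiff (i1 + i2) f)
   + of_nat (i1 + i2 + i3) * pvar i1 * pvar i2 * pvar i3 * pdiff (i1 + i2 + i3) f
   + of_nat (i1 + i2 + i3) * pvar (i1 + i2 + i3) * pdiff (i1 + i2 + i3) f"

text \<open>
  Applied to a given polynomial only finitely many of the summands are nonzero (lemma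
  \<open>finite_Delta3_support\<close>), so \<^const>\<open>Sum_any\<close> is the intended sum over all triples of
  positive integers.
\<close>

definition Delta3 :: "cpoly \<Rightarrow> cpoly" where
  "Delta3 f = pconst (1/3) *
     Sum_any (\<lambda>(i1, i2, i3). Delta3_term i1 i2 i3 f when (1 \<le> i1 \<and> 1 \<le> i2 \<and> 1 \<le> i3))"

lemma pdiff_0 [simp]: "pdiff i 0 = 0"
  by (simp add: pdiff_def)

lemma pdiff_eq_0: "pdiff i f = 0" if "\<And>m. m \<in> Poly_Mapping.keys f \<Longrightarrow> Poly_Mapping.lookup m i = 0"
  using that by (simp add: pdiff_def)

lemma keys_pdiff:
  assumes "m \<in> Poly_Mapping.keys (pdiff i f)"
  obtains m' where "m' \<in> Poly_Mapping.keys f" "m = m' - Poly_Mapping.single i 1"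
proof -
  obtain m' where m': "m' \<in> Poly_Mapping.keys f"
    "m \<in> Poly_Mapping.keys (Poly_Mapping.single (m' - Poly_Mapping.single i 1)
       (Poly_Mapping.lookup f m' * of_nat (Poly_Mapping.lookup m' i)))"
    using subsetD[OF keys_sum assms[unfolded pdiff_def]] by (rule UN_E)
  have "m = m' - Poly_Mapping.single i 1"
    using m'(2) by (simp only: keys_single split: if_splits) simp_all
  with m'(1) show ?thesis by (rule that)
qed

lemma pdiff_eq_0_pdiff:
  assumes "\<And>m. m \<in> Poly_Mapping.keys f \<Longrightarrow> Poly_Mapping.lookup m i = 0"
    and "m \<in> Poly_Mapping.keys (pdiff j f)"
  shows "Poly_Mapping.lookup m i = 0"
  using assms(2)
proof (rule keys_pdiff)
  fix m' assume "m' \<in> Poly_Mapping.keys f" "m = m' - Poly_Mapping.single j 1"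
  then show ?thesis using assms(1)[of m'] by (simp add: lookup_minus)
qed

lemma finite_Delta3_support:
  "finite {(i1, i2, i3). Delta3_term i1 i2 i3 f \<noteq> 0 \<and> 1 \<le> i1 \<and> 1 \<le> i2 \<and> 1 \<le> i3}"
proof -
  define V where "V = (\<Union>m\<in>Poly_Mapping.keys f. Poly_Mapping.keys m)"
  have "finite V" by (simp add: V_def)
  then have N: "i \<le> Max V" if "i \<in> V" for i using that by (rule Max_ge)
  define N where "N = Max V"
  note N = N[folded N_def]
  have Z: "Poly_Mapping.lookup m i = 0" if "m \<in> Poly_Mapping.keys f" "N < i" for m i
  proof -
    from that N have "i \<notin> V" by (meson not_le)
    with that have "i \<notin> Poly_Mapping.keys m" unfolding V_def by blast
    then show ?thesis by (simp add: in_keys_iff)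
  qed
  have Z1: "pdiff i f = 0" if "N < i" for i
    using Z that by (intro pdiff_eq_0) auto
  have Z2: "pdiff i (pdiff j f) = 0" if "N < i" for i j
    by (rule pdiff_eq_0, rule pdiff_eq_0_pdiff[of f], use Z that in auto)
  have Z3: "pdiff i (pdiff j (pdiff k f)) = 0" if "N < i" for i j k
    by (rule pdiff_eq_0, rule pdiff_eq_0_pdiff[of "pdiff k f"], rule pdiff_eq_0_pdiff[of f])
       (use Z that in auto)
  have "i1 \<le> N \<and> i2 \<le> N \<and> i3 \<le> N" if nz: "Delta3_term i1 i2 i3 f \<noteq> 0" for i1 i2 i3
  proof -
    have "Delta3_term i1 i2 i3 f = 0" if "N < i1 \<or> N < i2 \<or> N < i3"
    proof -
      have "pdiff (i1 + i2 + i3) f = 0"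
        by (rule Z1) (use that in linarith)
      moreover have "pdiff i1 (pdiff i2 (pdiff i3 f)) = 0"
        using that Z1[of i3] Z2[of i2 i3] Z3[of i1 i2 i3] by force
      moreover have "pdiff i1 (pdiff (i2 + i3) f) = 0"
        using that Z1[of "i2 + i3"] Z2[of i1 "i2 + i3"] by force
      moreover have "pdiff i2 (pdiff (i1 + i3) f) = 0"
        using that Z1[of "i1 + i3"] Z2[of i2 "i1 + i3"] by force
      moreover have "pdiff i3 (pdiff (i1 + i2) f) = 0"
        using that Z1[of "i1 + i2"] Z2[of i3 "i1 + i2"] by force
      ultimately show ?thesis
        unfolding Delta3_term_def by (simp only: mult_zero_right add_0_right)
    qed
    with nz have "\<not> (N < i1 \<or> N < i2 \<or> N < i3)" by blast
    then show ?thesis by auto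
  qed
  then have "{(i1, i2, i3). Delta3_term i1 i2 i3 f \<noteq> 0 \<and> 1 \<le> i1 \<and> 1 \<le> i2 \<and> 1 \<le> i3}
      \<subseteq> {..N} \<times> {..N} \<times> {..N}"
    by blast
  then show ?thesis by (rule finite_subset) auto
qed

text \<open>
  An element of \<open>\<complex>S\<^sub>n\<close> is a finitely supported function on permutations, where \<open>Poly_Mapping.single \<sigma> 1\<close>
  is the basis element of \<open>\<sigma>\<close>.
\<close>

type_synonym perm_alg = "(nat \<Rightarrow> nat) \<Rightarrow>\<^sub>0 complex"

definition group_alg :: "nat \<Rightarrow> perm_alg set" where
  "group_alg n = {g. Poly_Mapping.keys g \<subseteq> carrier (sym_group n)}"

definition alg_mult :: "perm_alg \<Rightarrow> perm_alg \<Rightarrow> perm_alg" where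
  "alg_mult f g = (\<Sum>\<sigma>\<in>Poly_Mapping.keys f. \<Sum>\<tau>\<in>Poly_Mapping.keys g.
     Poly_Mapping.single (\<sigma> \<circ> \<tau>) (Poly_Mapping.lookup f \<sigma> * Poly_Mapping.lookup g \<tau>))"

definition cycle_type :: "nat \<Rightarrow> (nat \<Rightarrow> nat) \<Rightarrow> nat multiset" where
  "cycle_type n \<sigma> = image_mset card (mset_set (orbit \<sigma> ` {1..n}))"

definition Phi :: "nat \<Rightarrow> perm_alg \<Rightarrow> cpoly" where
  "Phi n g = (\<Sum>\<sigma>\<in>Poly_Mapping.keys g.
     pconst (Poly_Mapping.lookup g \<sigma>) * prod_mset (image_mset pvar (cycle_type n \<sigma>)))"

definition K3 :: "nat \<Rightarrow> perm_alg" where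
  "K3 n = (\<Sum>\<sigma>\<in>three_cycles n. Poly_Mapping.single \<sigma> 1)"

text \<open>\<^term>\<open>cycle_of_list [j3, j2, j1]\<close> is the cycle \<open>j3 \<mapsto> j2 \<mapsto> j1 \<mapsto> j3\<close>.\<close>

definition K3bar_mult :: "nat \<Rightarrow> perm_alg \<Rightarrow> perm_alg" where
  "K3bar_mult n g =
     (\<Sum>(j3, j2, j1)\<in>{(j3, j2, j1). {j3, j2, j1} \<subseteq> {1..n} \<and> distinct [j3, j2, j1]}.
        alg_mult (Poly_Mapping.single (cycle_of_list [j3, j2, j1]) 1) g)"

end

theory Submission
  imports Defs
begin

text \<open>
  Both sides are linear in \<open>g\<close>, so let \<open>g = \<sigma>\<close>. The cycle lengths of \<open>(j\<^sub>3 j\<^sub>2 j\<^sub>1) \<sigma>\<close> depend only on how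
  \<open>j\<^sub>1, j\<^sub>2, j\<^sub>3\<close> are distributed over the cycles of \<open>\<sigma>\<close>: three different cycles are merged into one;
  if one index lies in a cycle and the other two in another, an arc is moved from the second cycle to
  the first; if all three lie in one cycle, it is cut into three cycles or remains one cycle,
  according to their cyclic order. On the other side, \<open>i \<partial>/\<partial>p\<^sub>i\<close> applied to the product of the \<open>p\<^bsub>|X|\<^esub>\<close> over
  the cycles \<open>X\<close> is the sum, over all points \<open>j\<close> on a cycle of length \<open>i\<close>, of the product with the cycle of
  \<open>j\<close> left out. Hence the summands of \<open>\<Delta>\<^sub>3\<close> count the triples of each kind.
\<close>

section \<open>Orbits and explicit cycles\<close>

text \<open>The rotation equation writes a cycle out in order, the last entry going back to the
  first. The lists need not exhaust the cycles of \<open>f\<close>: below, only the cycles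
  containing indices of the 3-cycle are listed.\<close>

definition cycles_of :: "('a \<Rightarrow> 'a) \<Rightarrow> 'a list list \<Rightarrow> bool" where
  "cycles_of f xss \<longleftrightarrow> distinct (concat xss) \<and> (\<forall>xs\<in>set xss. xs \<noteq> [] \<and> map f xs = rotate1 xs)"

text \<open>Indexing by the orbits instead of their lengths allows one particular cycle to be
  removed, and cycles of equal length still contribute separate factors.\<close>

definition orbits_poly :: "nat set set \<Rightarrow> cpoly" where
  "orbits_poly A = (\<Prod>X\<in>A. pvar (card X))"

text \<open>Iterating the rotation \<open>n\<close> times shows that \<open>(f ^^ n) (hd xs)\<close>
  is the entry at position \<open>n mod length xs\<close>, so the powers of \<open>f\<close> run
  through exactly the list.\<close>

lemma cyclic_on_set_rotation:
  assumes "xs \<noteq> []" and rot: "map f xs = rotate1 xs"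
  shows "cyclic_on f (set xs)"
proof -
  have pow: "map (f ^^ n) xs = rotate n xs" for n
  proof (induction n)
    case (Suc n)
    have "map (f ^^ Suc n) xs = map f (map (f ^^ n) xs)" by simp
    also have "\<dots> = rotate n (rotate1 xs)" by (simp only: Suc rotate_map[symmetric] rot)
    finally show ?case by (simp add: rotate1_rotate_swap o_def)
  qed simp
  then have hd: "(f ^^ n) (hd xs) = xs ! (n mod length xs)" for n
    using assms(1) by (metis hd_map hd_rotate_conv_nth)
  have "orbit f (hd xs) = set xs"
  proof (rule equalityI; rule subsetI)
    fix y assume "y \<in> orbit f (hd xs)"
    then show "y \<in> set xs"
      using assms(1) by (auto simp: orbit_altdef hd)
  next
    fix y assume "y \<in> set xs"
    then obtain i where i: "i < length xs" "y = xs ! i"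
      by (auto simp: in_set_conv_nth)
    \<comment> \<open>An orbit consists of the values of the positive powers, so one full turn is
      added to cover \<open>i = 0\<close>.\<close>
    then have "(f ^^ (i + length xs)) (hd xs) = y" by (simp add: hd)
    moreover have "0 < i + length xs" using i by linarith
    ultimately show "y \<in> orbit f (hd xs)"
      unfolding orbit_altdef by blast
  qed
  then show ?thesis
    using hd_in_set[OF assms(1)] by (intro cyclic_on_singleI) auto
qed

text \<open>The first return time \<open>funpow_dist1 f x x\<close> is the size of the orbit: before
  it the powers are injective and already exhaust the orbit.\<close>

lemma orbit_list:
  fixes f :: "'a \<Rightarrow> 'a" and x :: 'a
  assumes "permutation f"
  defines "xs \<equiv> map (\<lambda>k. (f ^^ k) x) [0..<card (orbit f x)]"
  shows "distinct xs" "set xs = orbit f x" "(f ^^ card (orbit f x)) x = x" "card (orbit f x) > 0"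
proof -
  have self: "x \<in> orbit f x" by (rule permutation_self_in_orbit) fact
  have inj: "inj_on (\<lambda>k. (f ^^ k) x) {0..<funpow_dist1 f x x}"
    by (rule inj_on_funpow_dist1[OF self])
  have card: "card (orbit f x) = funpow_dist1 f x x"
    using orbit_conv_funpow_dist1[OF self] card_image[OF inj] by simp
  show "distinct xs" "set xs = orbit f x"
    unfolding xs_def card
    using inj orbit_conv_funpow_dist1[OF self] by (simp_all only: distinct_map distinct_upt set_upt set_map)
  show "(f ^^ card (orbit f x)) x = x"
    unfolding card by (rule funpow_dist1_prop[OF self])
  show "card (orbit f x) > 0" by (simp add: card)
qed

lemma orbit_eq_iff:
  assumes "permutation f"
  shows "orbit f x = orbit f y \<longleftrightarrow> x \<in> orbit f y"
  using assms by (metis cyclic_on_orbit' orbit_cyclic_eq3 permutation_self_in_orbit)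

text \<open>A cycle of \<sigma> outside the listed ones is also a cycle of \<tau>, as the two maps
  agree along it; the remaining points are covered by \<open>yss\<close>. Hence only the factors of
  the listed cycles are exchanged.\<close>

lemma orbits_poly_replace:
  fixes \<sigma> \<tau> :: "nat \<Rightarrow> nat"
  assumes S: "finite S" "\<sigma> permutes S"
    and xss: "cycles_of \<sigma> xss" and yss: "cycles_of \<tau> yss"
    and un: "set (concat xss) = set (concat yss)" "set (concat xss) \<subseteq> S"
    and eq: "\<And>x. x \<notin> set (concat xss) \<Longrightarrow> \<tau> x = \<sigma> x"
  shows "orbits_poly (orbit \<tau> ` S) =
    (\<Prod>ys\<leftarrow>yss. pvar (length ys)) * orbits_poly (orbit \<sigma> ` S - set ` set xss)"
proof -
  have perm: "permutation \<sigma>" using S by (auto simp: permutation_permutes)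
  have cx: "cyclic_on \<sigma> (set xs)" if "xs \<in> set xss" for xs
    using xss that by (intro cyclic_on_set_rotation) (auto simp: cycles_of_def)
  have cy: "cyclic_on \<tau> (set ys)" if "ys \<in> set yss" for ys
    using yss that by (intro cyclic_on_set_rotation) (auto simp: cycles_of_def)
  have old: "orbit \<tau> x = orbit \<sigma> x" if "x \<notin> set (concat xss)" for x
  proof (rule orbit_cong)
    show self: "x \<in> orbit \<sigma> x" by (rule permutation_self_in_orbit) fact
    fix y assume y: "y \<in> orbit \<sigma> x"
    \<comment> \<open>The listed sets are whole orbits of \<sigma>, so an orbit starting outside
      them never enters them.\<close>
    have "y \<notin> set xs" if "xs \<in> set xss" for xs
    proof
      assume "y \<in> set xs"
      then have "orbit \<sigma> y = set xs" using cx that by (meson orbit_cyclic_eq3)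
      moreover have "x \<in> orbit \<sigma> y" using y perm orbit_eq_iff by metis
      ultimately show False using \<open>x \<notin> _\<close> that by auto
    qed
    then show "\<tau> y = \<sigma> y" by (intro eq) auto
  qed
  have oldset: "orbit \<sigma> x \<in> orbit \<sigma> ` S - set ` set xss \<longleftrightarrow> x \<notin> set (concat xss)" if "x \<in> S" for x
  proof
    assume *: "orbit \<sigma> x \<in> orbit \<sigma> ` S - set ` set xss"
    have "x \<notin> set xs" if "xs \<in> set xss" for xs
    proof
      assume "x \<in> set xs"
      then have "orbit \<sigma> x = set xs" using cx that by (meson orbit_cyclic_eq3)
      then show False using * that by auto
    qed
    then show "x \<notin> set (concat xss)" by auto
  next
    assume *: "x \<notin> set (concat xss)"
    have "orbit \<sigma> x \<noteq> set xs" if "xs \<in> set xss" for xs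
      using * that permutation_self_in_orbit[OF perm, of x] by auto
    then show "orbit \<sigma> x \<in> orbit \<sigma> ` S - set ` set xss" using \<open>x \<in> S\<close> by auto
  qed
  have orbs: "orbit \<tau> ` S = set ` set yss \<union> (orbit \<sigma> ` S - set ` set xss)"
  proof (rule equalityI; rule subsetI)
    fix X assume "X \<in> orbit \<tau> ` S"
    then obtain x where x: "x \<in> S" "X = orbit \<tau> x" by auto
    show "X \<in> set ` set yss \<union> (orbit \<sigma> ` S - set ` set xss)"
    proof (cases "x \<in> set (concat xss)")
      case True
      then obtain ys where "ys \<in> set yss" "x \<in> set ys" using un by auto
      then have "X = set ys" using x cy by (metis orbit_cyclic_eq3)
      then show ?thesis using \<open>ys \<in> set yss\<close> by blast
    next
      case False
      then have "X = orbit \<sigma> x" using x old by simp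
      then show ?thesis using False oldset[OF x(1)] by blast
    qed
  next
    fix X assume "X \<in> set ` set yss \<union> (orbit \<sigma> ` S - set ` set xss)"
    then show "X \<in> orbit \<tau> ` S"
    proof
      assume "X \<in> set ` set yss"
      then obtain ys where ys: "ys \<in> set yss" "X = set ys" by auto
      then have "ys \<noteq> []" using yss by (auto simp: cycles_of_def)
      then obtain y where "y \<in> set ys" using hd_in_set by blast
      moreover have "y \<in> S" using un ys \<open>y \<in> set ys\<close> by auto
      moreover have "orbit \<tau> y = X" using ys cy \<open>y \<in> set ys\<close> by (metis orbit_cyclic_eq3)
      ultimately show ?thesis by blast
    next
      assume "X \<in> orbit \<sigma> ` S - set ` set xss"
      then obtain x where x: "x \<in> S" "X = orbit \<sigma> x" "orbit \<sigma> x \<in> orbit \<sigma> ` S - set ` set xss" by auto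
      then have "orbit \<tau> x = X" using oldset old by metis
      then show ?thesis using x by blast
    qed
  qed
  have disj: "set ` set yss \<inter> (orbit \<sigma> ` S - set ` set xss) = {}"
  proof (rule ccontr)
    assume "\<not> ?thesis"
    then obtain ys x where *: "ys \<in> set yss" "x \<in> S" "set ys = orbit \<sigma> x"
        "orbit \<sigma> x \<in> orbit \<sigma> ` S - set ` set xss" by auto
    then have "x \<notin> set (concat xss)" using oldset by blast
    moreover have "x \<in> set ys" using * permutation_self_in_orbit[OF perm] by metis
    moreover have "set ys \<subseteq> set (concat yss)" using *(1) by auto
    ultimately show False using un(1) by blast
  qed
  \<comment> \<open>Nonempty disjoint lists have different sets, so passing from sets to lists in
    the product neither loses nor repeats a factor.\<close>
  have "distinct yss" and inj: "inj_on set (set yss)"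
  proof -
    have "\<And>ys. ys \<in> set yss \<Longrightarrow> ys \<noteq> []" "distinct (concat yss)"
      using yss by (auto simp: cycles_of_def)
    then have "[] \<notin> set yss" by blast
    then show "distinct yss" using \<open>distinct (concat yss)\<close> by (simp add: distinct_concat_iff)
    show "inj_on set (set yss)"
      using \<open>distinct (concat yss)\<close> \<open>[] \<notin> set yss\<close>
      by (auto simp: distinct_concat_iff intro!: inj_onI) (metis Int_absorb set_empty)
  qed
  have "orbits_poly (set ` set yss) = (\<Prod>ys\<in>set yss. pvar (card (set ys)))"
    by (simp add: orbits_poly_def prod.reindex[OF inj])
  also have "\<dots> = (\<Prod>ys\<in>set yss. pvar (length ys))"
    using yss by (intro prod.cong) (auto simp: cycles_of_def distinct_concat_iff distinct_card)
  also have "\<dots> = (\<Prod>ys\<leftarrow>yss. pvar (length ys))"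
    using \<open>distinct yss\<close> by (rule prod.distinct_set_conv_list)
  finally have "orbits_poly (set ` set yss) = (\<Prod>ys\<leftarrow>yss. pvar (length ys))" .
  then show ?thesis
    unfolding orbs orbits_poly_def using disj S(1) by (subst prod.union_disjoint) auto
qed

section \<open>Multiplication by a 3-cycle\<close>

lemma cycle_of_list_3:
  assumes "distinct [a, b, c]"
  shows "cycle_of_list [a, b, c] a = b" "cycle_of_list [a, b, c] b = c" "cycle_of_list [a, b, c] c = a"
  using assms by (auto simp: transpose_def)

lemma map_cycle_of_list_outside:
  assumes "set xs \<inter> set cs = {}"
  shows "map (cycle_of_list cs) xs = xs"
  using assms by (auto intro!: map_idI id_outside_supp)

text \<open>This cuts the rotation equation of a whole cycle into one equation for each of its
  arcs.\<close>

lemma map_append_eqD: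
  assumes "map f (xs @ ys) = zs @ ws" "length zs = length xs"
  shows "map f xs = zs" "map f ys = ws"
  using assms by auto

text \<open>
  Each list \<open>x # xs\<close> below is an arc of a cycle of \<open>\<sigma>\<close> containing no other index of the 3-cycle. Multiplying by
  the 3-cycle only changes which arc follows it.
\<close>

lemma three_cycle_merge:
  assumes "cycles_of \<sigma> [a # as, b # bs, c # cs]"
  shows "cycles_of (cycle_of_list [c, b, a] \<circ> \<sigma>) [a # as @ c # cs @ b # bs]"
proof -
  let ?p = "cycle_of_list [c, b, a]"
  have d: "distinct (a # as @ b # bs @ c # cs)"
    and m: "map \<sigma> (a # as) = as @ [a]" "map \<sigma> (b # bs) = bs @ [b]" "map \<sigma> (c # cs) = cs @ [c]"
    using assms by (simp_all add: cycles_of_def)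
  note p = cycle_of_list_3[of c b a] map_cycle_of_list_outside[of _ "[c, b, a]"]
  have "map (?p \<circ> \<sigma>) (a # as) = as @ [c]" "map (?p \<circ> \<sigma>) (b # bs) = bs @ [a]" "map (?p \<circ> \<sigma>) (c # cs) = cs @ [b]"
    unfolding map_map[symmetric] m using d by (auto simp: p simp del: cycle_of_list.simps)
  then show ?thesis using d by (auto simp: cycles_of_def simp del: cycle_of_list.simps)
qed

text \<open>The arc \<open>b # bs\<close> closes up, since its last point used to go to
  \<open>c\<close> and \<open>c\<close> is sent to \<open>b\<close>; the arc of \<open>c\<close> is
  entered from that of \<open>a\<close> and returns to \<open>a\<close>.\<close>

lemma three_cycle_transfer:
  assumes "cycles_of \<sigma> [a # as, b # bs @ c # cs]"
  shows "cycles_of (cycle_of_list [c, b, a] \<circ> \<sigma>) [b # bs, a # as @ c # cs]"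
proof -
  let ?p = "cycle_of_list [c, b, a]"
  have d: "distinct (a # as @ b # bs @ c # cs)"
    and m: "map \<sigma> (a # as) = as @ [a]" and m': "map \<sigma> ((b # bs) @ (c # cs)) = (bs @ [c]) @ (cs @ [b])"
    using assms by (simp_all add: cycles_of_def)
  note m = m map_append_eqD[OF m', simplified length_append list.size add_0_right add_Suc_right, OF refl]
  note p = cycle_of_list_3[of c b a] map_cycle_of_list_outside[of _ "[c, b, a]"]
  have "map (?p \<circ> \<sigma>) (a # as) = as @ [c]" "map (?p \<circ> \<sigma>) (b # bs) = bs @ [b]" "map (?p \<circ> \<sigma>) (c # cs) = cs @ [a]"
    unfolding map_map[symmetric] m using d by (auto simp: p simp del: cycle_of_list.simps)
  then show ?thesis using d by (auto simp: cycles_of_def simp del: cycle_of_list.simps)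
qed

text \<open>Here \<sigma> meets the indices in the cyclic order opposite to that of the 3-cycle, so
  the last point of each arc is sent back to the start of the same arc.\<close>

lemma three_cycle_split:
  assumes "cycles_of \<sigma> [b # bs @ c # cs @ a # as]"
  shows "cycles_of (cycle_of_list [c, b, a] \<circ> \<sigma>) [b # bs, c # cs, a # as]"
proof -
  let ?p = "cycle_of_list [c, b, a]"
  have d: "distinct (a # as @ b # bs @ c # cs)"
    and m': "map \<sigma> ((b # bs) @ (c # cs @ a # as)) = (bs @ [c]) @ (cs @ a # as @ [b])"
    using assms by (auto simp: cycles_of_def)
  note m' = map_append_eqD[OF m', simplified length_append list.size add_0_right add_Suc_right, OF refl]
  \<comment> \<open>A second cut follows, as the first only separates the arc of \<open>b\<close>
    from the other two.\<close>
  have m'': "map \<sigma> ((c # cs) @ (a # as)) = (cs @ [a]) @ (as @ [b])"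
    using m' by simp
  note m = m'(1) map_append_eqD[OF m'', simplified length_append list.size add_0_right add_Suc_right, OF refl]
  note p = cycle_of_list_3[of c b a] map_cycle_of_list_outside[of _ "[c, b, a]"]
  have "map (?p \<circ> \<sigma>) (a # as) = as @ [a]" "map (?p \<circ> \<sigma>) (b # bs) = bs @ [b]" "map (?p \<circ> \<sigma>) (c # cs) = cs @ [c]"
    unfolding map_map[symmetric] m using d by (auto simp: p simp del: cycle_of_list.simps)
  then show ?thesis using d by (auto simp: cycles_of_def simp del: cycle_of_list.simps)
qed

text \<open>Here \<sigma> meets the indices in the order of the 3-cycle itself: every arc is
  followed by the arc after next, which with three arcs again gives a single cycle.\<close>

lemma three_cycle_reorder:
  assumes "cycles_of \<sigma> [b # bs @ a # as @ c # cs]"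
  shows "cycles_of (cycle_of_list [c, b, a] \<circ> \<sigma>) [b # bs @ c # cs @ a # as]"
proof -
  let ?p = "cycle_of_list [c, b, a]"
  have d: "distinct (a # as @ b # bs @ c # cs)"
    and m': "map \<sigma> ((b # bs) @ (a # as @ c # cs)) = (bs @ [a]) @ (as @ c # cs @ [b])"
    using assms by (auto simp: cycles_of_def)
  note m' = map_append_eqD[OF m', simplified length_append list.size add_0_right add_Suc_right, OF refl]
  have m'': "map \<sigma> ((a # as) @ (c # cs)) = (as @ [c]) @ (cs @ [b])"
    using m' by simp
  note m = m'(1) map_append_eqD[OF m'', simplified length_append list.size add_0_right add_Suc_right, OF refl]
  note p = cycle_of_list_3[of c b a] map_cycle_of_list_outside[of _ "[c, b, a]"]
  have "map (?p \<circ> \<sigma>) (a # as) = as @ [b]" "map (?p \<circ> \<sigma>) (b # bs) = bs @ [c]" "map (?p \<circ> \<sigma>) (c # cs) = cs @ [a]"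
    unfolding map_map[symmetric] m using d by (auto simp: p simp del: cycle_of_list.simps)
  then show ?thesis using d by (auto simp: cycles_of_def simp del: cycle_of_list.simps)
qed

section \<open>The monomial of a 3-cycle times \<sigma>, by the position of the indices\<close>

locale perm_upto =
  fixes n :: nat and \<sigma> :: "nat \<Rightarrow> nat"
  assumes permutes: "\<sigma> permutes {1..n}"
begin

abbreviation orb :: "nat \<Rightarrow> nat set" where "orb \<equiv> orbit \<sigma>"

definition seg :: "nat \<Rightarrow> nat \<Rightarrow> nat \<Rightarrow> nat list" where
  "seg x i j = map (\<lambda>k. (\<sigma> ^^ k) x) [i..<j]"

text \<open>The partial derivatives remove one cycle after another, and \<open>P\<close> collects
  the cycles already removed; \<open>rest {}\<close> is the full monomial of \<sigma>.\<close>

definition rest :: "nat set set \<Rightarrow> cpoly" where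
  "rest P = orbits_poly (orb ` {1..n} - P)"

definition cycle3_poly :: "nat \<Rightarrow> nat \<Rightarrow> nat \<Rightarrow> cpoly" where
  "cycle3_poly j3 j2 j1 = orbits_poly (orbit (cycle_of_list [j3, j2, j1] \<circ> \<sigma>) ` {1..n})"

lemma permutation: "permutation \<sigma>"
  using permutes by (auto simp: permutation_permutes)

lemma self_in_orb: "x \<in> orb x"
  by (rule permutation_self_in_orbit[OF permutation])

lemma orb_subset: "x \<in> {1..n} \<Longrightarrow> orb x \<subseteq> {1..n}"
  using permutes by (rule permutes_orbit_subset)

lemma seg_Cons: "i < j \<Longrightarrow> seg x i j = (\<sigma> ^^ i) x # seg x (Suc i) j"
  by (simp add: seg_def upt_conv_Cons)

lemma seg_split: "i \<le> k \<Longrightarrow> k \<le> j \<Longrightarrow> seg x i j = seg x i k @ seg x k j"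
  by (auto simp: seg_def simp flip: map_append upt_add_eq_append dest: le_Suc_ex)

lemma length_seg [simp]: "length (seg x i j) = j - i"
  by (simp add: seg_def)

text \<open>When the orbit is read off the powers starting at \<open>x\<close>, the value at
  exponent \<open>L x\<close> is \<open>x\<close> again, which closes the rotation.\<close>

lemma orbit_cycle:
  defines "L \<equiv> \<lambda>x. card (orb x)"
  shows "set (seg x 0 (L x)) = orb x" "distinct (seg x 0 (L x))"
    "seg x 0 (L x) \<noteq> []" "map \<sigma> (seg x 0 (L x)) = rotate1 (seg x 0 (L x))" "L x > 0"
proof -
  note o = orbit_list[OF permutation, of x]
  show "set (seg x 0 (L x)) = orb x" "distinct (seg x 0 (L x))" "L x > 0"
    using o unfolding seg_def L_def by auto
  then show "seg x 0 (L x) \<noteq> []" by (simp add: seg_def)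
  have "map \<sigma> (seg x 0 (L x)) = map (\<lambda>k. (\<sigma> ^^ k) x) (map Suc [0..<L x])"
    by (simp add: seg_def)
  also have "\<dots> = seg x 1 (L x) @ [x]"
    using o(3,4) unfolding seg_def map_Suc_upt by (simp add: L_def)
  also have "\<dots> = rotate1 (seg x 0 (L x))"
    using \<open>L x > 0\<close> by (simp add: seg_Cons)
  finally show "map \<sigma> (seg x 0 (L x)) = rotate1 (seg x 0 (L x))" .
qed

lemma orb_eq_iff: "orb x = orb y \<longleftrightarrow> x \<in> orb y"
  by (rule orbit_eq_iff[OF permutation])

lemma orb_disjoint: "orb x \<noteq> orb y \<Longrightarrow> orb x \<inter> orb y = {}"
  by (metis disjoint_iff orb_eq_iff)

text \<open>Exponents are distances along the cycle; this converts a sum over arc lengths into a sum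
  over a further point of the cycle. Exponent \<open>0\<close> is left out because it gives
  \<open>x\<close> itself.\<close>

lemma bij_betw_power_orb:
  "bij_betw (\<lambda>k. (\<sigma> ^^ k) x) {1..<card (orb x)} (orb x - {x})"
proof -
  let ?L = "card (orb x)"
  have "bij_betw (\<lambda>k. (\<sigma> ^^ k) x) {0..<?L} (orb x)"
    using orbit_cycle(1,2)[of x] by (auto simp: bij_betw_def seg_def distinct_map)
  then have "bij_betw (\<lambda>k. (\<sigma> ^^ k) x) ({0..<?L} - {0}) (orb x - {(\<sigma> ^^ 0) x})"
    by (rule bij_betw_DiffI) (use orbit_cycle(5)[of x] in \<open>auto simp: self_in_orb bij_betw_def\<close>)
  moreover have "{0..<?L} - {0} = {1..<?L}" by auto
  ultimately show ?thesis by simp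
qed

text \<open>The parameters \<open>Xs\<close> and \<open>ls\<close> hold the old orbits and the new
  lengths, so each configuration only has to exhibit its explicit cycles before and after
  multiplication.\<close>

lemma cycle3_poly_replace:
  assumes "cycles_of \<sigma> xss" "cycles_of (cycle_of_list [j3, j2, j1] \<circ> \<sigma>) yss"
    and "set (concat xss) = set (concat yss)" "set (concat xss) \<subseteq> {1..n}"
    and "{j1, j2, j3} \<subseteq> set (concat xss)"
    and "map set xss = Xs" "map length yss = ls"
  shows "cycle3_poly j3 j2 j1 = (\<Prod>l\<leftarrow>ls. pvar l) * rest (set Xs)"
proof -
  have "cycle3_poly j3 j2 j1 = (\<Prod>ys\<leftarrow>yss. pvar (length ys)) * rest (set ` set xss)"
    unfolding cycle3_poly_def rest_def
  proof (rule orbits_poly_replace)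
    fix x assume x: "x \<notin> set (concat xss)"
    \<comment> \<open>A listed cycle contains the preimages of its points, so \<sigma> maps the
      outside to the outside, where the 3-cycle fixes every point.\<close>
    have "\<sigma> x \<notin> set (concat xss)"
    proof
      assume "\<sigma> x \<in> set (concat xss)"
      then obtain xs where xs: "xs \<in> set xss" "\<sigma> x \<in> set xs" by auto
      have "cyclic_on \<sigma> (set xs)"
        by (rule cyclic_on_set_rotation) (use assms(1) xs in \<open>auto simp: cycles_of_def\<close>)
      then show False using cyclic_on_f_in[OF permutes] xs x by auto
    qed
    then have "\<sigma> x \<notin> set [j3, j2, j1]" using assms(5) by auto
    then show "(cycle_of_list [j3, j2, j1] \<circ> \<sigma>) x = \<sigma> x"
      unfolding o_apply by (rule id_outside_supp)
  qed (use assms permutes in auto)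
  also have "(\<Prod>ys\<leftarrow>yss. pvar (length ys)) = (\<Prod>l\<leftarrow>ls. pvar l)"
    using assms(7) by (auto simp: o_def)
  also have "set ` set xss = set Xs" using assms(6) by auto
  finally show ?thesis .
qed

lemma cycle3_poly_merge:
  assumes "{j1, j2, j3} \<subseteq> {1..n}" "orb j1 \<noteq> orb j2" "orb j1 \<noteq> orb j3" "orb j2 \<noteq> orb j3"
  shows "cycle3_poly j3 j2 j1 =
    pvar (card (orb j1) + card (orb j2) + card (orb j3)) * rest {orb j1, orb j2, orb j3}"
proof -
  let ?s = "\<lambda>x. seg x 0 (card (orb x))"
  have s: "?s x = x # seg x 1 (card (orb x))" for x
    using orbit_cycle(5)[of x] by (simp add: seg_Cons)
  have "cycles_of \<sigma> [?s j1, ?s j2, ?s j3]"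
    using orbit_cycle assms(2-4)[THEN orb_disjoint] by (auto simp: cycles_of_def)
  note c = this[unfolded s]
  have o: "set (x # seg x 1 (card (orb x))) = orb x" for x using orbit_cycle(1)[of x] s by simp
  have "cycle3_poly j3 j2 j1 = (\<Prod>l\<leftarrow>[card (orb j1) + card (orb j2) + card (orb j3)]. pvar l)
    * rest (set [orb j1, orb j2, orb j3])"
    using c three_cycle_merge[OF c]
  proof (rule cycle3_poly_replace, goal_cases)
    case 2
    show ?case using assms(1) orb_subset
      by (simp only: o concat.simps set_append append_Nil2) auto
  next
    case 4
    show ?case by (simp only: list.map o)
  qed (use orbit_cycle(5)[of j1] orbit_cycle(5)[of j2] orbit_cycle(5)[of j3] in auto)
  then show ?thesis by simp
qed

text \<open>Cutting the cycle of \<open>j2\<close> at distance \<open>k\<close> gives an arc of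
  length \<open>k\<close> starting at \<open>j2\<close>, which becomes a cycle, and a remaining arc,
  which joins the cycle of \<open>j1\<close>.\<close>

lemma cycle3_poly_transfer:
  assumes "{j1, j2} \<subseteq> {1..n}" "orb j1 \<noteq> orb j2" "k \<in> {1..<card (orb j2)}"
  shows "cycle3_poly ((\<sigma> ^^ k) j2) j2 j1 =
    pvar (card (orb j1) + (card (orb j2) - k)) * pvar k * rest {orb j1, orb j2}"
proof -
  let ?L = "card (orb j2)"
  have s1: "seg j1 0 (card (orb j1)) = j1 # seg j1 1 (card (orb j1))"
    using orbit_cycle(5)[of j1] by (simp add: seg_Cons)
  have "seg j2 0 ?L = seg j2 0 k @ seg j2 k ?L"
    using assms(3) by (intro seg_split) auto
  also have "\<dots> = j2 # seg j2 1 k @ (\<sigma> ^^ k) j2 # seg j2 (Suc k) ?L"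
    using assms(3) by (simp add: seg_Cons)
  finally have s2: "seg j2 0 ?L = j2 # seg j2 1 k @ (\<sigma> ^^ k) j2 # seg j2 (Suc k) ?L" .
  have "cycles_of \<sigma> [seg j1 0 (card (orb j1)), seg j2 0 ?L]"
    using orbit_cycle assms(2)[THEN orb_disjoint] by (auto simp: cycles_of_def)
  note c = this[unfolded s1 s2]
  note o = orbit_cycle(1)[of j1, unfolded s1] orbit_cycle(1)[of j2, unfolded s2]
  have "cycle3_poly ((\<sigma> ^^ k) j2) j2 j1 =
    (\<Prod>l\<leftarrow>[k, card (orb j1) + (?L - k)]. pvar l) * rest (set [orb j1, orb j2])"
    using c three_cycle_transfer[OF c]
  proof (rule cycle3_poly_replace, goal_cases)
    case 2
    show ?case using assms(1) orb_subset
      by (simp only: o concat.simps set_append append_Nil2) auto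
  next
    case 4
    show ?case by (simp only: list.map o)
  qed (use assms(3) orbit_cycle(5)[of j1] in auto)
  then show ?thesis by (simp add: ac_simps)
qed

text \<open>With \<open>m < k\<close>, the index \<open>j3\<close> is met before \<open>j1\<close>,
  so the arcs lie in the order of \<open>three_cycle_split\<close>; their lengths are the gaps
  between \<open>0\<close>, \<open>m\<close>, \<open>k\<close> and the cycle length.\<close>

lemma cycle3_poly_split:
  assumes "j \<in> {1..n}" "0 < m" "m < k" "k < card (orb j)"
  shows "cycle3_poly ((\<sigma> ^^ m) j) j ((\<sigma> ^^ k) j) =
    pvar m * pvar (k - m) * pvar (card (orb j) - k) * rest {orb j}"
proof -
  let ?L = "card (orb j)"
  have "seg j 0 ?L = seg j 0 m @ seg j m k @ seg j k ?L"
    using assms(2-4) by (simp flip: seg_split)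
  also have "\<dots> = j # seg j 1 m @ (\<sigma> ^^ m) j # seg j (Suc m) k @ (\<sigma> ^^ k) j # seg j (Suc k) ?L"
    using assms(2-4) by (simp add: seg_Cons)
  finally have s: "seg j 0 ?L = j # seg j 1 m @ (\<sigma> ^^ m) j # seg j (Suc m) k @ (\<sigma> ^^ k) j # seg j (Suc k) ?L" .
  have "cycles_of \<sigma> [seg j 0 ?L]"
    using orbit_cycle by (auto simp: cycles_of_def)
  note c = this[unfolded s]
  note o = orbit_cycle(1)[of j, unfolded s]
  have "cycle3_poly ((\<sigma> ^^ m) j) j ((\<sigma> ^^ k) j) =
    (\<Prod>l\<leftarrow>[m, k - m, ?L - k]. pvar l) * rest (set [orb j])"
    using c three_cycle_split[OF c]
  proof (rule cycle3_poly_replace, goal_cases)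
    case 2
    show ?case using assms(1) orb_subset
      by (simp only: o concat.simps set_append append_Nil2)
  next
    case 4
    show ?case by (simp only: list.map o)
  qed (use assms in auto)
  then show ?thesis by (simp add: ac_simps)
qed

text \<open>The exponents keep their names but are ordered the other way: now \<open>j1\<close> is
  met before \<open>j3\<close>, which is the order of \<open>three_cycle_reorder\<close>.\<close>

lemma cycle3_poly_reorder:
  assumes "j \<in> {1..n}" "0 < k" "k < m" "m < card (orb j)"
  shows "cycle3_poly ((\<sigma> ^^ m) j) j ((\<sigma> ^^ k) j) = pvar (card (orb j)) * rest {orb j}"
proof -
  let ?L = "card (orb j)"
  have "seg j 0 ?L = seg j 0 k @ seg j k m @ seg j m ?L"
    using assms(2-4) by (simp flip: seg_split)
  also have "\<dots> = j # seg j 1 k @ (\<sigma> ^^ k) j # seg j (Suc k) m @ (\<sigma> ^^ m) j # seg j (Suc m) ?L"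
    using assms(2-4) by (simp add: seg_Cons)
  finally have s: "seg j 0 ?L = j # seg j 1 k @ (\<sigma> ^^ k) j # seg j (Suc k) m @ (\<sigma> ^^ m) j # seg j (Suc m) ?L" .
  have "cycles_of \<sigma> [seg j 0 ?L]"
    using orbit_cycle by (auto simp: cycles_of_def)
  note c = this[unfolded s]
  note o = orbit_cycle(1)[of j, unfolded s]
  have "cycle3_poly ((\<sigma> ^^ m) j) j ((\<sigma> ^^ k) j) = (\<Prod>l\<leftarrow>[?L]. pvar l) * rest (set [orb j])"
    using c three_cycle_reorder[OF c]
  proof (rule cycle3_poly_replace, goal_cases)
    case 2
    show ?case using assms(1) orb_subset
      by (simp only: o concat.simps set_append append_Nil2)
  next
    case 4
    show ?case by (simp only: list.map o)
  qed (use assms in auto)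
  then show ?thesis by simp
qed

end

section \<open>Derivatives of orbit monomials\<close>

lemma sum_keys_superset:
  fixes F :: "'k \<Rightarrow> 'b::zero \<Rightarrow> 'c::comm_monoid_add"
  assumes "\<And>k. F k 0 = 0" "finite A" "Poly_Mapping.keys f \<subseteq> A"
  shows "(\<Sum>k\<in>Poly_Mapping.keys f. F k (Poly_Mapping.lookup f k)) = (\<Sum>k\<in>A. F k (Poly_Mapping.lookup f k))"
  using assms by (intro sum.mono_neutral_left) (auto simp: in_keys_iff)

lemma pconst_mult: "pconst a * pconst b = pconst (a * b)"
  by (simp add: pconst_def mult_single)

lemma pconst_add: "pconst (a + b) = pconst a + pconst b"
  by (simp add: pconst_def single_add)

lemma pconst_0 [simp]: "pconst 0 = 0"
  by (simp add: pconst_def)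

lemma pconst_of_nat: "of_nat k = pconst (of_nat k)"
  by (simp add: pconst_def)

lemma pdiff_add: "pdiff i (f + g) = pdiff i f + pdiff i g"
  unfolding pdiff_def
  by (rule setsum_keys_plus_distrib) (simp_all add: single_add distrib_right)

lemma pdiff_pconst_mult: "pdiff i (pconst c * f) = pconst c * pdiff i f"
proof -
  have lk: "Poly_Mapping.lookup (pconst c * f) m = c * Poly_Mapping.lookup f m" for m
    unfolding pconst_def mult_map_scale_conv_mult[symmetric] by (simp add: map.rep_eq when_def)
  \<comment> \<open>For \<open>c = 0\<close> the product loses keys; summing over the keys of
    \<open>f\<close> adds only vanishing terms.\<close>
  have "pdiff i (pconst c * f) = (\<Sum>m\<in>Poly_Mapping.keys f.
     Poly_Mapping.single (m - Poly_Mapping.single i 1)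
       (Poly_Mapping.lookup (pconst c * f) m * of_nat (Poly_Mapping.lookup m i)))"
    unfolding pdiff_def by (intro sum_keys_superset) (auto simp: in_keys_iff lk)
  also have "\<dots> = pconst c * pdiff i f"
    unfolding pdiff_def sum_distrib_left
    by (intro sum.cong) (simp_all only: lk, simp_all add: pconst_def mult_single mult.assoc)
  finally show ?thesis .
qed

lemma pdiff_of_nat_mult: "pdiff i (of_nat k * f) = of_nat k * pdiff i f"
  by (simp only: pconst_of_nat pdiff_pconst_mult)

lemma orbits_poly_monomial:
  "orbits_poly A = Poly_Mapping.single (\<Sum>X\<in>A. Poly_Mapping.single (card X) 1) 1"
  unfolding orbits_poly_def by (induction A rule: infinite_finite_induct) (auto simp: pvar_def mult_single)

text \<open>The exponent of variable \<open>i\<close> counts the orbits of size \<open>i\<close>,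
  and deleting any one of them leaves the same monomial with this exponent lowered by one.\<close>

lemma pdiff_orbits_poly:
  assumes "finite A"
  shows "pdiff i (orbits_poly A) = (\<Sum>X | X \<in> A \<and> card X = i. orbits_poly (A - {X}))"
proof -
  define M :: "nat \<Rightarrow>\<^sub>0 nat" where "M = (\<Sum>X\<in>A. Poly_Mapping.single (card X) 1)"
  have "Poly_Mapping.lookup M i = (\<Sum>X\<in>A. if card X = i then 1 else 0)"
    unfolding M_def lookup_sum by (intro sum.cong) (auto simp: lookup_single)
  also have "\<dots> = card {X \<in> A. card X = i}"
    using assms by (simp add: sum.If_cases Int_def)
  finally have M: "Poly_Mapping.lookup M i = card {X \<in> A. card X = i}" .
  have "orbits_poly (A - {X}) = Poly_Mapping.single (M - Poly_Mapping.single i 1) 1"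
    if "X \<in> A" "card X = i" for X
    using that assms by (simp add: orbits_poly_monomial M_def sum.remove[of A X])
  then have "(\<Sum>X | X \<in> A \<and> card X = i. orbits_poly (A - {X})) =
      of_nat (Poly_Mapping.lookup M i) * Poly_Mapping.single (M - Poly_Mapping.single i 1) 1"
    by (simp add: M)
  also have "\<dots> = Poly_Mapping.single (M - Poly_Mapping.single i 1) (of_nat (Poly_Mapping.lookup M i))"
    unfolding pconst_of_nat pconst_def mult_single by simp
  also have "\<dots> = pdiff i (orbits_poly A)"
    by (simp add: pdiff_def orbits_poly_monomial M_def)
  finally show ?thesis ..
qed

lemma additive_sum:
  fixes F :: "'b::ab_group_add \<Rightarrow> 'c::ab_group_add"
  assumes "\<And>f g. F (f + g) = F f + F g"
  shows "F (sum h A) = (\<Sum>x\<in>A. F (h x))"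
proof -
  have "F 0 = 0" using assms[of 0 0] by simp
  then show ?thesis by (induction A rule: infinite_finite_induct) (auto simp: assms)
qed

section \<open>Derivatives as sums over points on cycles\<close>

context perm_upto
begin

abbreviation avoiding :: "nat set set \<Rightarrow> nat set" where
  "avoiding P \<equiv> {j \<in> {1..n}. orb j \<notin> P}"

text \<open>The derivative is a sum over the cycles of length \<open>i\<close>; the factor
  \<open>i\<close> counts the points of each, which turns it into a sum over points.\<close>

lemma of_nat_mult_pdiff_rest:
  "of_nat i * pdiff i (rest P) =
    (\<Sum>j | j \<in> avoiding P \<and> i = card (orb j). rest (insert (orb j) P))"
proof -
  let ?J = "{j. j \<in> avoiding P \<and> i = card (orb j)}"
  let ?O = "{X. X \<in> orb ` {1..n} - P \<and> card X = i}"
  have fib: "{j \<in> ?J. orb j = X} = X" if X: "X \<in> ?O" for X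
  proof (rule equalityI; rule subsetI)
    fix j assume "j \<in> X"
    moreover obtain x where x: "x \<in> {1..n}" "X = orb x" using X by auto
    ultimately have "orb j = X" "j \<in> {1..n}" using orb_eq_iff[of j x] orb_subset[of x] by auto
    then show "j \<in> {j \<in> ?J. orb j = X}" using that by auto
  qed (use self_in_orb in auto)
  have im: "orb ` ?J = ?O" by auto
  have "(\<Sum>j\<in>?J. rest (insert (orb j) P)) = (\<Sum>X\<in>?O. \<Sum>j | j \<in> ?J \<and> orb j = X. rest (insert (orb j) P))"
    using sum.image_gen[of ?J "\<lambda>j. rest (insert (orb j) P)" orb] im by simp
  also have "\<dots> = (\<Sum>X\<in>?O. of_nat (card X) * rest (insert X P))"
  proof (rule sum.cong)
    fix X assume X: "X \<in> ?O"
    have "(\<Sum>j | j \<in> ?J \<and> orb j = X. rest (insert (orb j) P)) = (\<Sum>j | j \<in> ?J \<and> orb j = X. rest (insert X P))"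
      by (rule sum.cong) auto
    also have "\<dots> = of_nat (card X) * rest (insert X P)"
      unfolding fib[OF X] by simp
    finally show "(\<Sum>j | j \<in> ?J \<and> orb j = X. rest (insert (orb j) P)) = of_nat (card X) * rest (insert X P)" .
  qed simp
  also have "\<dots> = of_nat i * (\<Sum>X\<in>?O. rest (insert X P))"
    by (simp add: sum_distrib_left)
  also have "(\<Sum>X\<in>?O. rest (insert X P)) = pdiff i (rest P)"
    unfolding rest_def by (subst pdiff_orbits_poly) (auto intro!: sum.cong arg_cong[of _ _ orbits_poly])
  finally show ?thesis ..
qed

text \<open>
  The case of \<open>F a\<close> linear and \<open>s a\<close> a sum of up to three indices covers every summand of \<open>\<Delta>\<^sub>3\<close>: the
  derivative picks a point \<open>j\<close> whose cycle is removed, and the indices become arc lengths on that cycle.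
\<close>

lemma sum_pdiff_rest:
  fixes F :: "'a \<Rightarrow> cpoly \<Rightarrow> cpoly"
  assumes "finite A" and "\<And>a f g. F a (f + g) = F a f + F a g"
  shows "(\<Sum>a\<in>A. F a (of_nat (s a) * pdiff (s a) (rest P))) =
    (\<Sum>j\<in>avoiding P. \<Sum>a | a \<in> A \<and> s a = card (orb j). F a (rest (insert (orb j) P)))"
proof -
  have "(\<Sum>a\<in>A. F a (of_nat (s a) * pdiff (s a) (rest P))) =
    (\<Sum>a\<in>A. \<Sum>j | j \<in> avoiding P \<and> s a = card (orb j). F a (rest (insert (orb j) P)))"
    unfolding of_nat_mult_pdiff_rest using assms(2) by (intro sum.cong additive_sum) auto
  also have "\<dots> = (\<Sum>j\<in>avoiding P. \<Sum>a | a \<in> A \<and> s a = card (orb j). F a (rest (insert (orb j) P)))"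
    by (rule sum.swap_restrict) (use assms(1) in auto)
  finally show ?thesis .
qed

lemma card_orb_le: "j \<in> {1..n} \<Longrightarrow> card (orb j) \<le> n"
  using card_mono[OF _ orb_subset] by fastforce

text \<open>As \<open>N\<close> is at least \<open>n\<close>, every cycle length occurs among the
  indices, so for each point exactly one index survives.\<close>

lemma sum_pdiff_rest1:
  fixes F :: "nat \<Rightarrow> cpoly \<Rightarrow> cpoly"
  assumes "n \<le> N" and "\<And>a f g. F a (f + g) = F a f + F a g"
  shows "(\<Sum>a=1..N. F a (of_nat a * pdiff a (rest P))) =
    (\<Sum>j\<in>avoiding P. F (card (orb j)) (rest (insert (orb j) P)))"
proof -
  have "{a \<in> {1..N}. a = card (orb j)} = {card (orb j)}" if "j \<in> avoiding P" for j
    using that card_orb_le[of j] orbit_cycle(5)[of j] assms(1) by auto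
  then show ?thesis
    using assms by (subst sum_pdiff_rest[where s = "\<lambda>a. a"]) auto
qed

text \<open>An index pair whose sum is the cycle length is a cut of the cycle into two nonempty
  arcs; the first index is the position \<open>k\<close> of the cut.\<close>

lemma sum_pdiff_rest2:
  fixes F :: "nat \<Rightarrow> nat \<Rightarrow> cpoly \<Rightarrow> cpoly"
  assumes "n \<le> N" and "\<And>a b f g. F a b (f + g) = F a b f + F a b g"
  shows "(\<Sum>a=1..N. \<Sum>b=1..N. F a b (of_nat (a + b) * pdiff (a + b) (rest P))) =
    (\<Sum>j\<in>avoiding P. \<Sum>k=1..<card (orb j). F k (card (orb j) - k) (rest (insert (orb j) P)))"
proof -
  let ?I = "{1..N} \<times> {1..N}"
  have "(\<Sum>a=1..N. \<Sum>b=1..N. F a b (of_nat (a + b) * pdiff (a + b) (rest P))) =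
    (\<Sum>t\<in>?I. (\<lambda>(a, b). F a b) t (of_nat ((\<lambda>(a, b). a + b) t) * pdiff ((\<lambda>(a, b). a + b) t) (rest P)))"
    by (simp add: sum.cartesian_product case_prod_unfold)
  also have "\<dots> = (\<Sum>j\<in>avoiding P. \<Sum>t | t \<in> ?I \<and> (\<lambda>(a, b). a + b) t = card (orb j).
      (\<lambda>(a, b). F a b) t (rest (insert (orb j) P)))"
    by (rule sum_pdiff_rest) (auto simp: assms(2))
  also have "\<dots> = (\<Sum>j\<in>avoiding P. \<Sum>k=1..<card (orb j). F k (card (orb j) - k) (rest (insert (orb j) P)))"
  proof (rule sum.cong[OF refl])
    fix j assume "j \<in> avoiding P"
    then have "card (orb j) \<le> N" using card_orb_le[of j] assms(1) by auto
    then show "(\<Sum>t | t \<in> ?I \<and> (\<lambda>(a, b). a + b) t = card (orb j). (\<lambda>(a, b). F a b) t (rest (insert (orb j) P)))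
      = (\<Sum>k=1..<card (orb j). F k (card (orb j) - k) (rest (insert (orb j) P)))"
      by (intro sum.reindex_bij_witness[of _ "\<lambda>k. (k, card (orb j) - k)" fst])
         (auto, metis add_diff_cancel_left')
  qed
  finally show ?thesis .
qed

text \<open>Two cuts at \<open>m = a\<close> and \<open>k = a + b\<close> encode an index triple
  whose sum is the cycle length; positivity of the three indices becomes \<open>0 < m\<close>,
  \<open>m < k\<close> and \<open>k < card (orb j)\<close>.\<close>

lemma sum_pdiff_rest3:
  fixes F :: "nat \<Rightarrow> nat \<Rightarrow> nat \<Rightarrow> cpoly \<Rightarrow> cpoly"
  assumes "n \<le> N" and "\<And>a b c f g. F a b c (f + g) = F a b c f + F a b c g"
  shows "(\<Sum>a=1..N. \<Sum>b=1..N. \<Sum>c=1..N. F a b c (of_nat (a + b + c) * pdiff (a + b + c) (rest P))) =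
    (\<Sum>j\<in>avoiding P. \<Sum>k=1..<card (orb j). \<Sum>m=1..<k.
      F m (k - m) (card (orb j) - k) (rest (insert (orb j) P)))"
proof -
  let ?I = "{1..N} \<times> {1..N} \<times> {1..N}"
  let ?s = "\<lambda>(a, b, c). a + b + c"
  let ?F = "\<lambda>(a, b, c). F a b c"
  have "(\<Sum>a=1..N. \<Sum>b=1..N. \<Sum>c=1..N. F a b c (of_nat (a + b + c) * pdiff (a + b + c) (rest P))) =
    (\<Sum>t\<in>?I. ?F t (of_nat (?s t) * pdiff (?s t) (rest P)))"
    by (simp add: sum.cartesian_product case_prod_unfold)
  also have "\<dots> = (\<Sum>j\<in>avoiding P. \<Sum>t | t \<in> ?I \<and> ?s t = card (orb j). ?F t (rest (insert (orb j) P)))"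
    by (rule sum_pdiff_rest) (auto simp: assms(2))
  also have "\<dots> = (\<Sum>j\<in>avoiding P. \<Sum>k=1..<card (orb j). \<Sum>m=1..<k.
      F m (k - m) (card (orb j) - k) (rest (insert (orb j) P)))"
  proof (rule sum.cong[OF refl])
    fix j assume "j \<in> avoiding P"
    then have "card (orb j) \<le> N" using card_orb_le[of j] assms(1) by auto
    then have "(\<Sum>t | t \<in> ?I \<and> ?s t = card (orb j). ?F t (rest (insert (orb j) P)))
      = (\<Sum>(k, m)\<in>(SIGMA k:{1..<card (orb j)}. {1..<k}). F m (k - m) (card (orb j) - k) (rest (insert (orb j) P)))"
      by (intro sum.reindex_bij_witness[of _ "\<lambda>(k, m). (m, k - m, card (orb j) - k)" "\<lambda>(a, b, c). (a + b, a)"])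
         (auto, metis add_diff_cancel_left')
    then show "(\<Sum>t | t \<in> ?I \<and> ?s t = card (orb j). ?F t (rest (insert (orb j) P)))
      = (\<Sum>k=1..<card (orb j). \<Sum>m=1..<k. F m (k - m) (card (orb j) - k) (rest (insert (orb j) P)))"
      by (simp add: sum.Sigma)
  qed
  finally show ?thesis .
qed

end

section \<open>Summation over triples\<close>

definition triples :: "nat \<Rightarrow> (nat \<times> nat \<times> nat) set" where
  "triples n = {(j3, j2, j1). {j3, j2, j1} \<subseteq> {1..n} \<and> distinct [j3, j2, j1]}"

lemma finite_triples: "finite (triples n)"
  by (rule finite_subset[of _ "{1..n} \<times> {1..n} \<times> {1..n}"]) (auto simp: triples_def)

lemma triples_rotate: "(a, b, c) \<in> triples n \<longleftrightarrow> (b, c, a) \<in> triples n"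
  by (auto simp: triples_def)

lemma cycle_of_list_3_rotate:
  assumes "distinct [a, b, c]"
  shows "cycle_of_list [a, b, c] = cycle_of_list [b, c, a]"
  using cycle_of_list_rotate_independent[OF assms, of 1] by simp

section \<open>Matching each kind of summand with its triples\<close>

context perm_upto
begin

lemma orb_eqI: "y \<in> orb x \<Longrightarrow> orb y = orb x"
  by (simp add: orb_eq_iff)

lemma finite_orb: "finite (orb x)"
  by (rule finite_orbit[OF self_in_orb])

lemma sum_power_orb: "(\<Sum>k=1..<card (orb x). f ((\<sigma> ^^ k) x)) = (\<Sum>y\<in>orb x - {x}. f y)"
  by (rule sum.reindex_bij_betw[OF bij_betw_power_orb])

lemma cycle3_poly_rotate:
  assumes "(j3, j2, j1) \<in> triples n"
  shows "cycle3_poly j3 j2 j1 = cycle3_poly j2 j1 j3"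
proof -
  have "distinct [j3, j2, j1]" using assms by (simp add: triples_def)
  then show ?thesis unfolding cycle3_poly_def by (simp only: cycle_of_list_3_rotate)
qed

text \<open>Rotated triples define the same 3-cycle, so a condition may be moved from one pair of
  indices to another.\<close>

lemma sum_cycle3_poly_rotate:
  "(\<Sum>(j3, j2, j1) | (j3, j2, j1) \<in> triples n \<and> P j3 j2 j1. cycle3_poly j3 j2 j1) =
   (\<Sum>(j3, j2, j1) | (j3, j2, j1) \<in> triples n \<and> P j1 j3 j2. cycle3_poly j3 j2 j1)"
proof (rule sum.reindex_bij_witness[of _ "\<lambda>(a, b, c). (c, a, b)" "\<lambda>(a, b, c). (b, c, a)"], goal_cases)
  case (2 t)
  then show ?case using triples_rotate by (auto split: prod.splits)
next
  case (4 t)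
  then show ?case using triples_rotate by (auto split: prod.splits)
next
  case (5 t)
  then show ?case by (auto split: prod.splits intro: cycle3_poly_rotate[symmetric])
qed auto

text \<open>The derivatives are peeled off from the innermost one, each choosing a point on a cycle
  not chosen before; the points chosen form exactly the triples that merge three cycles.\<close>

lemma sum_merge:
  assumes "n \<le> N"
  shows "(\<Sum>i1=1..N. \<Sum>i2=1..N. \<Sum>i3=1..N.
      of_nat (i1 * i2 * i3) * pvar (i1 + i2 + i3) * pdiff i1 (pdiff i2 (pdiff i3 (rest {})))) =
    (\<Sum>(j3, j2, j1) | (j3, j2, j1) \<in> triples n \<and> orb j1 \<noteq> orb j2 \<and> orb j1 \<noteq> orb j3 \<and> orb j2 \<noteq> orb j3.
      cycle3_poly j3 j2 j1)"
proof -
  \<comment> \<open>The sum over \<open>i3\<close> is moved outwards and written as a map applied to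
    \<open>of_nat i3 * pdiff i3 (rest {})\<close>, the form that \<open>sum_pdiff_rest1\<close>
    rewrites; \<open>i2\<close> and \<open>i1\<close> follow in the same way.\<close>
  have "(\<Sum>i1=1..N. \<Sum>i2=1..N. \<Sum>i3=1..N.
      of_nat (i1 * i2 * i3) * pvar (i1 + i2 + i3) * pdiff i1 (pdiff i2 (pdiff i3 (rest {})))) =
    (\<Sum>i3=1..N. (\<lambda>i3 f. \<Sum>i2=1..N. \<Sum>i1=1..N. of_nat (i1 * i2) * pvar (i1 + i2 + i3) * pdiff i1 (pdiff i2 f))
      i3 (of_nat i3 * pdiff i3 (rest {})))"
    unfolding pdiff_of_nat_mult
    by (subst sum.swap, subst (2) sum.swap, subst sum.swap) (simp add: mult_ac)
  also have "\<dots> = (\<Sum>j3\<in>avoiding {}. \<Sum>i2=1..N. \<Sum>i1=1..N.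
      of_nat (i1 * i2) * pvar (i1 + i2 + card (orb j3)) * pdiff i1 (pdiff i2 (rest {orb j3})))"
    by (subst sum_pdiff_rest1[OF assms]) (simp_all add: pdiff_add distrib_left sum.distrib)
  also have "\<dots> = (\<Sum>j3\<in>avoiding {}. \<Sum>i2=1..N.
      (\<lambda>i2 f. \<Sum>i1=1..N. of_nat i1 * pvar (i1 + i2 + card (orb j3)) * pdiff i1 f) i2 (of_nat i2 * pdiff i2 (rest {orb j3})))"
    unfolding pdiff_of_nat_mult by (simp add: mult_ac)
  also have "\<dots> = (\<Sum>j3\<in>avoiding {}. \<Sum>j2\<in>avoiding {orb j3}. \<Sum>i1=1..N.
      of_nat i1 * pvar (i1 + card (orb j2) + card (orb j3)) * pdiff i1 (rest {orb j2, orb j3}))"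
    by (subst sum_pdiff_rest1[OF assms]) (simp_all add: pdiff_add distrib_left sum.distrib)
  also have "\<dots> = (\<Sum>j3\<in>avoiding {}. \<Sum>j2\<in>avoiding {orb j3}. \<Sum>i1=1..N.
      (\<lambda>i1 f. pvar (i1 + card (orb j2) + card (orb j3)) * f) i1 (of_nat i1 * pdiff i1 (rest {orb j2, orb j3})))"
    by (simp add: mult_ac)
  also have "\<dots> = (\<Sum>j3\<in>avoiding {}. \<Sum>j2\<in>avoiding {orb j3}. \<Sum>j1\<in>avoiding {orb j2, orb j3}.
      pvar (card (orb j1) + card (orb j2) + card (orb j3)) * rest {orb j1, orb j2, orb j3})"
    by (subst sum_pdiff_rest1[OF assms]) (simp_all add: distrib_left)
  also have "\<dots> = (\<Sum>j3\<in>avoiding {}. \<Sum>j2\<in>avoiding {orb j3}. \<Sum>j1\<in>avoiding {orb j2, orb j3}. cycle3_poly j3 j2 j1)"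
    by (intro sum.cong refl cycle3_poly_merge[symmetric]) auto
  also have "\<dots> = (\<Sum>(j3, j2, j1)\<in>(SIGMA j3:avoiding {}. SIGMA j2:avoiding {orb j3}. avoiding {orb j2, orb j3}).
      cycle3_poly j3 j2 j1)"
    by (simp add: sum.Sigma)
  also have "(SIGMA j3:avoiding {}. SIGMA j2:avoiding {orb j3}. avoiding {orb j2, orb j3}) =
    {(j3, j2, j1). (j3, j2, j1) \<in> triples n \<and> orb j1 \<noteq> orb j2 \<and> orb j1 \<noteq> orb j3 \<and> orb j2 \<noteq> orb j3}"
    unfolding triples_def by auto
  finally show ?thesis .
qed

text \<open>The derivative of index \<open>i2 + i3\<close> chooses \<open>j2\<close> and cuts its
  cycle, \<open>i2\<close> being the distance from \<open>j2\<close> to \<open>j3\<close>. The other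
  derivative chooses \<open>j1\<close> on another cycle.\<close>

lemma sum_transfer:
  assumes "n \<le> N"
  shows "(\<Sum>i1=1..N. \<Sum>i2=1..N. \<Sum>i3=1..N.
      of_nat (i1 * (i2 + i3)) * pvar (i1 + i3) * pvar i2 * pdiff i1 (pdiff (i2 + i3) (rest {}))) =
    (\<Sum>(j3, j2, j1) | (j3, j2, j1) \<in> triples n \<and> orb j1 \<noteq> orb j2 \<and> orb j2 = orb j3. cycle3_poly j3 j2 j1)"
proof -
  have "(\<Sum>i1=1..N. \<Sum>i2=1..N. \<Sum>i3=1..N.
      of_nat (i1 * (i2 + i3)) * pvar (i1 + i3) * pvar i2 * pdiff i1 (pdiff (i2 + i3) (rest {}))) =
    (\<Sum>i2=1..N. \<Sum>i3=1..N. (\<lambda>i2 i3 f. \<Sum>i1=1..N. of_nat i1 * pvar (i1 + i3) * pvar i2 * pdiff i1 f)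
      i2 i3 (of_nat (i2 + i3) * pdiff (i2 + i3) (rest {})))"
    unfolding pdiff_of_nat_mult
    by (subst sum.swap, subst (2) sum.swap) (simp add: mult_ac del: of_nat_add)
  also have "\<dots> = (\<Sum>j2\<in>avoiding {}. \<Sum>k=1..<card (orb j2). \<Sum>i1=1..N.
      of_nat i1 * pvar (i1 + (card (orb j2) - k)) * pvar k * pdiff i1 (rest {orb j2}))"
    by (subst sum_pdiff_rest2[OF assms]) (simp_all add: pdiff_add distrib_left sum.distrib)
  also have "\<dots> = (\<Sum>j2\<in>avoiding {}. \<Sum>k=1..<card (orb j2). \<Sum>i1=1..N.
      (\<lambda>i1 f. pvar (i1 + (card (orb j2) - k)) * pvar k * f) i1 (of_nat i1 * pdiff i1 (rest {orb j2})))"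
    by (simp add: mult_ac)
  also have "\<dots> = (\<Sum>j2\<in>avoiding {}. \<Sum>k=1..<card (orb j2). \<Sum>j1\<in>avoiding {orb j2}.
      pvar (card (orb j1) + (card (orb j2) - k)) * pvar k * rest {orb j1, orb j2})"
    by (subst sum_pdiff_rest1[OF assms]) (simp_all add: distrib_left)
  also have "\<dots> = (\<Sum>j2\<in>avoiding {}. \<Sum>k=1..<card (orb j2). \<Sum>j1\<in>avoiding {orb j2}.
      cycle3_poly ((\<sigma> ^^ k) j2) j2 j1)"
    by (intro sum.cong refl cycle3_poly_transfer[symmetric]) auto
  also have "\<dots> = (\<Sum>j2\<in>avoiding {}. \<Sum>j3\<in>orb j2 - {j2}. \<Sum>j1\<in>avoiding {orb j2}. cycle3_poly j3 j2 j1)"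
    by (simp only: sum_power_orb[where f = "\<lambda>j3. \<Sum>j1\<in>avoiding {orb j2}. cycle3_poly j3 j2 j1" and x = j2 for j2])
  also have "\<dots> = (\<Sum>(j2, j3, j1)\<in>(SIGMA j2:avoiding {}. SIGMA j3:orb j2 - {j2}. avoiding {orb j2}).
      cycle3_poly j3 j2 j1)"
    by (simp add: sum.Sigma finite_orb)
  also have "\<dots> = (\<Sum>(j3, j2, j1) | (j3, j2, j1) \<in> triples n \<and> orb j1 \<noteq> orb j2 \<and> orb j2 = orb j3. cycle3_poly j3 j2 j1)"
  proof (rule sum.reindex_bij_witness[of _ "\<lambda>(j3, j2, j1). (j2, j3, j1)" "\<lambda>(j2, j3, j1). (j3, j2, j1)"], goal_cases)
    case (2 t)
    obtain j2 j3 j1 where t: "t = (j2, j3, j1)" by (cases t)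
    then have "orb j3 = orb j2" "j3 \<in> {1..n}"
      using 2 orb_eqI[of j3 j2] orb_subset[of j2] by auto
    then show ?case using 2 t by (auto simp: triples_def)
  next
    case (4 t)
    then show ?case using self_in_orb by (auto simp: triples_def)
  qed auto
  finally show ?thesis .
qed

text \<open>Both summands cut the cycle of one point \<open>j\<close> at distances
  \<open>m < k\<close>. The product of three variables accounts for one assignment of the cut points
  to \<open>j3\<close> and \<open>j1\<close>, the single variable for the other.\<close>

lemma sum_split_reorder:
  assumes "n \<le> N"
  shows "(\<Sum>i1=1..N. \<Sum>i2=1..N. \<Sum>i3=1..N.
      of_nat (i1 + i2 + i3) * pvar i1 * pvar i2 * pvar i3 * pdiff (i1 + i2 + i3) (rest {})
      + of_nat (i1 + i2 + i3) * pvar (i1 + i2 + i3) * pdiff (i1 + i2 + i3) (rest {})) =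
    (\<Sum>(j3, j2, j1) | (j3, j2, j1) \<in> triples n \<and> orb j1 = orb j2 \<and> orb j2 = orb j3. cycle3_poly j3 j2 j1)"
proof -
  let ?c = "\<lambda>j m k. cycle3_poly ((\<sigma> ^^ m) j) j ((\<sigma> ^^ k) j)"
  have "(\<Sum>i1=1..N. \<Sum>i2=1..N. \<Sum>i3=1..N.
      of_nat (i1 + i2 + i3) * pvar i1 * pvar i2 * pvar i3 * pdiff (i1 + i2 + i3) (rest {})
      + of_nat (i1 + i2 + i3) * pvar (i1 + i2 + i3) * pdiff (i1 + i2 + i3) (rest {})) =
    (\<Sum>i1=1..N. \<Sum>i2=1..N. \<Sum>i3=1..N.
      (\<lambda>i1 i2 i3 f. (pvar i1 * pvar i2 * pvar i3 + pvar (i1 + i2 + i3)) * f) i1 i2 i3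
        (of_nat (i1 + i2 + i3) * pdiff (i1 + i2 + i3) (rest {})))"
    by (simp add: algebra_simps)
  also have "\<dots> = (\<Sum>j\<in>avoiding {}. \<Sum>k=1..<card (orb j). \<Sum>m=1..<k.
      (pvar m * pvar (k - m) * pvar (card (orb j) - k) + pvar (m + (k - m) + (card (orb j) - k))) * rest {orb j})"
    by (subst sum_pdiff_rest3[OF assms]) (simp_all add: distrib_left)
  also have "\<dots> = (\<Sum>j\<in>avoiding {}. \<Sum>k=1..<card (orb j). \<Sum>m=1..<k. ?c j m k + ?c j k m)"
    by (intro sum.cong refl) (auto simp: cycle3_poly_split cycle3_poly_reorder distrib_right)
  also have "\<dots> = (\<Sum>j\<in>avoiding {}. \<Sum>k=1..<card (orb j). \<Sum>m\<in>{1..<card (orb j)} - {k}. ?c j m k)"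
  proof (rule sum.cong[OF refl])
    fix j
    let ?L = "card (orb j)"
    \<comment> \<open>Exchanging the names of the exponents turns the second assignment into the
      pairs with \<open>m > k\<close>; together with the first, all pairs with
      \<open>m \<noteq> k\<close> occur.\<close>
    have swap: "(\<Sum>k=1..<?L. \<Sum>m=1..<k. ?c j k m) = (\<Sum>k=1..<?L. \<Sum>m=Suc k..<?L. ?c j m k)"
      unfolding sum.Sigma[OF finite_atLeastLessThan ballI[OF finite_atLeastLessThan]]
      by (rule sum.reindex_bij_witness[of _ "\<lambda>(k, m). (m, k)" "\<lambda>(k, m). (m, k)"]) auto
    have "(\<Sum>m=1..<k. ?c j m k) + (\<Sum>m=Suc k..<?L. ?c j m k) = (\<Sum>m\<in>{1..<?L} - {k}. ?c j m k)"
      if "k \<in> {1..<?L}" for k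
    proof -
      have "{1..<?L} - {k} = {1..<k} \<union> {Suc k..<?L}" using that by auto
      then show ?thesis by (simp add: sum.union_disjoint)
    qed
    then have "(\<Sum>k=1..<?L. (\<Sum>m=1..<k. ?c j m k) + (\<Sum>m=Suc k..<?L. ?c j m k)) =
        (\<Sum>k=1..<?L. \<Sum>m\<in>{1..<?L} - {k}. ?c j m k)"
      by (intro sum.cong refl)
    then show "(\<Sum>k=1..<?L. \<Sum>m=1..<k. ?c j m k + ?c j k m) = (\<Sum>k=1..<?L. \<Sum>m\<in>{1..<?L} - {k}. ?c j m k)"
      by (simp only: sum.distrib swap)
  qed
  also have "\<dots> = (\<Sum>j\<in>avoiding {}. \<Sum>k=1..<card (orb j). \<Sum>j3\<in>orb j - {j} - {(\<sigma> ^^ k) j}. cycle3_poly j3 j ((\<sigma> ^^ k) j))"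
  proof (rule sum.cong[OF refl], rule sum.cong[OF refl])
    fix j k assume k: "k \<in> {1..<card (orb j)}"
    then have "(\<sigma> ^^ k) j \<in> orb j - {j}" using bij_betwE[OF bij_betw_power_orb] by blast
    then have "bij_betw (\<lambda>m. (\<sigma> ^^ m) j) ({1..<card (orb j)} - {k}) (orb j - {j} - {(\<sigma> ^^ k) j})"
      by (intro bij_betw_DiffI[OF bij_betw_power_orb])
         (use k in \<open>auto simp: bij_betw_def\<close>)
    then show "(\<Sum>m\<in>{1..<card (orb j)} - {k}. ?c j m k) =
        (\<Sum>j3\<in>orb j - {j} - {(\<sigma> ^^ k) j}. cycle3_poly j3 j ((\<sigma> ^^ k) j))"
      by (rule sum.reindex_bij_betw)
  qed
  also have "\<dots> = (\<Sum>j2\<in>avoiding {}. \<Sum>j1\<in>orb j2 - {j2}. \<Sum>j3\<in>orb j2 - {j2} - {j1}. cycle3_poly j3 j2 j1)"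
    by (simp only: sum_power_orb[where f = "\<lambda>j1. \<Sum>j3\<in>orb j2 - {j2} - {j1}. cycle3_poly j3 j2 j1" and x = j2 for j2])
  also have "\<dots> = (\<Sum>(j2, j1, j3)\<in>(SIGMA j2:avoiding {}. SIGMA j1:orb j2 - {j2}. orb j2 - {j2} - {j1}).
      cycle3_poly j3 j2 j1)"
    by (simp add: sum.Sigma finite_orb)
  also have "\<dots> = (\<Sum>(j3, j2, j1) | (j3, j2, j1) \<in> triples n \<and> orb j1 = orb j2 \<and> orb j2 = orb j3. cycle3_poly j3 j2 j1)"
  proof (rule sum.reindex_bij_witness[of _ "\<lambda>(j3, j2, j1). (j2, j1, j3)" "\<lambda>(j2, j1, j3). (j3, j2, j1)"], goal_cases)
    case (2 t)
    obtain j2 j1 j3 where t: "t = (j2, j1, j3)" by (cases t)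
    then have "orb j3 = orb j2" "j3 \<in> {1..n}" "orb j1 = orb j2" "j1 \<in> {1..n}"
      using 2 orb_eqI[of j3 j2] orb_eqI[of j1 j2] orb_subset[of j2] by auto
    then show ?case using 2 t by (auto simp: triples_def)
  next
    case (4 t)
    then show ?case using self_in_orb by (auto simp: triples_def)
  qed auto
  finally show ?thesis .
qed

text \<open>Triples are sorted by which of their cycles coincide: none, exactly one pair, or all.
  Rotating the triples identifies the three classes with one pair, just as rotating the indices
  identifies the three second-order summands.\<close>

lemma sum_Delta3_term_rest:
  assumes "n \<le> N"
  shows "(\<Sum>i1=1..N. \<Sum>i2=1..N. \<Sum>i3=1..N. Delta3_term i1 i2 i3 (rest {})) =
    (\<Sum>(j3, j2, j1)\<in>triples n. cycle3_poly j3 j2 j1)"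
proof -
  let ?h = "\<lambda>(j3, j2, j1). cycle3_poly j3 j2 j1"
  let ?T = "\<lambda>i1 i2 i3. of_nat (i1 * (i2 + i3)) * pvar (i1 + i3) * pvar i2 * pdiff i1 (pdiff (i2 + i3) (rest {}))"
  let ?A = "{(j3, j2, j1). (j3, j2, j1) \<in> triples n \<and> orb j1 \<noteq> orb j2 \<and> orb j1 \<noteq> orb j3 \<and> orb j2 \<noteq> orb j3}"
  let ?B1 = "{(j3, j2, j1). (j3, j2, j1) \<in> triples n \<and> orb j1 \<noteq> orb j2 \<and> orb j2 = orb j3}"
  let ?B2 = "{(j3, j2, j1). (j3, j2, j1) \<in> triples n \<and> orb j2 \<noteq> orb j3 \<and> orb j3 = orb j1}"
  let ?B3 = "{(j3, j2, j1). (j3, j2, j1) \<in> triples n \<and> orb j3 \<noteq> orb j1 \<and> orb j1 = orb j2}"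
  let ?C = "{(j3, j2, j1). (j3, j2, j1) \<in> triples n \<and> orb j1 = orb j2 \<and> orb j2 = orb j3}"
  have fin: "finite ?A" "finite ?B1" "finite ?B2" "finite ?B3" "finite ?C"
    by (rule finite_subset[OF _ finite_triples[of n]]; auto)+
  have un: "triples n = ?A \<union> ?B1 \<union> ?B2 \<union> ?B3 \<union> ?C" by auto
  have "sum ?h (?A \<union> ?B1 \<union> ?B2 \<union> ?B3 \<union> ?C) = sum ?h ?A + sum ?h ?B1 + sum ?h ?B2 + sum ?h ?B3 + sum ?h ?C"
    using fin by (subst sum.union_disjoint; (auto; fail)?)+
  moreover have "sum ?h ?B3 = sum ?h ?B1"
    by (rule sum_cycle3_poly_rotate[of "\<lambda>j3 j2 j1. orb j3 \<noteq> orb j1 \<and> orb j1 = orb j2"])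
  moreover have "sum ?h ?B2 = sum ?h ?B3"
    by (rule sum_cycle3_poly_rotate[of "\<lambda>j3 j2 j1. orb j2 \<noteq> orb j3 \<and> orb j3 = orb j1"])
  ultimately have T: "sum ?h (triples n) = sum ?h ?A + sum ?h ?B1 + sum ?h ?B1 + sum ?h ?B1 + sum ?h ?C"
    using arg_cong[OF un, of "sum ?h"] by argo
  have T3: "(\<Sum>i1=1..N. \<Sum>i2=1..N. \<Sum>i3=1..N. ?T i2 i3 i1) = sum ?h ?B1"
    unfolding sum_transfer[OF assms, symmetric] by (subst sum.swap, subst (2) sum.swap) (rule refl)
  have T4: "(\<Sum>i1=1..N. \<Sum>i2=1..N. \<Sum>i3=1..N. ?T i3 i1 i2) = sum ?h ?B1"
    unfolding sum_transfer[OF assms, symmetric] by (subst (2) sum.swap, subst sum.swap) (rule refl)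
  have "(\<Sum>i1=1..N. \<Sum>i2=1..N. \<Sum>i3=1..N. Delta3_term i1 i2 i3 (rest {})) =
    (\<Sum>i1=1..N. \<Sum>i2=1..N. \<Sum>i3=1..N.
      of_nat (i1 * i2 * i3) * pvar (i1 + i2 + i3) * pdiff i1 (pdiff i2 (pdiff i3 (rest {})))
      + ?T i1 i2 i3 + ?T i2 i3 i1 + ?T i3 i1 i2 +
      (of_nat (i1 + i2 + i3) * pvar i1 * pvar i2 * pvar i3 * pdiff (i1 + i2 + i3) (rest {})
      + of_nat (i1 + i2 + i3) * pvar (i1 + i2 + i3) * pdiff (i1 + i2 + i3) (rest {})))"
    unfolding Delta3_term_def
  proof (rule sum.cong[OF refl], rule sum.cong[OF refl], rule sum.cong[OF refl])
    fix i1 i2 i3 :: nat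
    show "of_nat (i1 * i2 * i3) * pvar (i1 + i2 + i3) * pdiff i1 (pdiff i2 (pdiff i3 (rest {})))
      + of_nat (i1 * (i2 + i3)) * pvar (i1 + i3) * pvar i2 * pdiff i1 (pdiff (i2 + i3) (rest {}))
      + of_nat (i2 * (i1 + i3)) * pvar (i1 + i2) * pvar i3 * pdiff i2 (pdiff (i1 + i3) (rest {}))
      + of_nat (i3 * (i1 + i2)) * pvar (i3 + i2) * pvar i1 * pdiff i3 (pdiff (i1 + i2) (rest {}))
      + of_nat (i1 + i2 + i3) * pvar i1 * pvar i2 * pvar i3 * pdiff (i1 + i2 + i3) (rest {})
      + of_nat (i1 + i2 + i3) * pvar (i1 + i2 + i3) * pdiff (i1 + i2 + i3) (rest {}) =
      of_nat (i1 * i2 * i3) * pvar (i1 + i2 + i3) * pdiff i1 (pdiff i2 (pdiff i3 (rest {})))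
      + ?T i1 i2 i3 + ?T i2 i3 i1 + ?T i3 i1 i2 +
      (of_nat (i1 + i2 + i3) * pvar i1 * pvar i2 * pvar i3 * pdiff (i1 + i2 + i3) (rest {})
      + of_nat (i1 + i2 + i3) * pvar (i1 + i2 + i3) * pdiff (i1 + i2 + i3) (rest {}))"
      \<comment> \<open>Apart from bracketing, the two sides differ only in the order of addends
        inside the indices.\<close>
      unfolding add.commute[of i3 i1] add.commute[of i2 i1] by (simp only: add.assoc)
  qed
  also have "\<dots> = sum ?h ?A + sum ?h ?B1 + sum ?h ?B1 + sum ?h ?B1 + sum ?h ?C"
    by (simp only: sum.distrib T3 T4 sum_transfer[OF assms] sum_merge[OF assms] sum_split_reorder[OF assms, unfolded sum.distrib])
  finally show ?thesis using T by (rule trans[OF _ sym])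
qed

end

section \<open>The group algebra\<close>

text \<open>A 3-cycle determines its triple up to rotation, so it arises from exactly three
  triples.\<close>

lemma sum_3cycles:
  fixes F :: "(nat \<Rightarrow> nat) \<Rightarrow> cpoly"
  shows "(\<Sum>(j3, j2, j1)\<in>triples n. F (cycle_of_list [j3, j2, j1])) = 3 * (\<Sum>c\<in>three_cycles n. F c)"
proof -
  let ?c = "\<lambda>(j3, j2, j1). cycle_of_list [j3, j2, j1]"
  have im: "?c ` triples n = three_cycles n"
  proof (rule equalityI; rule subsetI)
    fix p assume "p \<in> ?c ` triples n"
    then obtain a b c where "p = cycle_of_list [a, b, c]" "(a, b, c) \<in> triples n" by auto
    then show "p \<in> three_cycles n"
      by (intro CollectI exI[of _ "[a, b, c]"]) (simp add: triples_def)
  next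
    fix p assume "p \<in> three_cycles n"
    then obtain cs where cs: "p = cycle_of_list cs" "distinct cs" "length cs = 3" "set cs \<subseteq> {1..n}" by blast
    \<comment> \<open>\<open>stupid_lemma\<close> writes a list of length three in terms of its
      entries.\<close>
    then obtain a b c where abc: "cs = [a, b, c]" using stupid_lemma by blast
    with cs have "(a, b, c) \<in> triples n" by (simp add: triples_def)
    moreover have "p = ?c (a, b, c)" by (simp only: cs(1) abc prod.case)
    ultimately show "p \<in> ?c ` triples n" by (rule rev_image_eqI)
  qed
  have card: "card {t \<in> triples n. ?c t = p} = 3" if "p \<in> three_cycles n" for p
  proof -
    obtain x y z where p: "p = cycle_of_list [x, y, z]" and xyz: "(x, y, z) \<in> triples n"
      using \<open>p \<in> three_cycles n\<close> unfolding im[symmetric] by auto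
    then have d: "distinct [x, y, z]" by (simp add: triples_def)
    note px = cycle_of_list_3[OF d, folded p]
    have supp: "p w = w" if "w \<notin> {x, y, z}" for w
      using that unfolding p by (intro id_outside_supp) auto
    have "{t \<in> triples n. ?c t = p} = {(x, y, z), (y, z, x), (z, x, y)}"
    proof (rule equalityI; rule subsetI)
      fix t assume "t \<in> {t \<in> triples n. ?c t = p}"
      then obtain a b c where t: "t = (a, b, c)" "(a, b, c) \<in> triples n" "cycle_of_list [a, b, c] = p"
        by (cases t) auto
      then have d': "distinct [a, b, c]" by (simp add: triples_def)
      note pa = cycle_of_list_3[OF d', unfolded t(3)]
      \<comment> \<open>The permutation \<open>p\<close> moves \<open>a\<close> to \<open>b\<close>,
        so \<open>a\<close> is one of the three moved points; then \<open>b\<close> and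
        \<open>c\<close> are forced as its successive images.\<close>
      have "a \<in> {x, y, z}" using supp[of a] pa(1) d' by auto
      then show "t \<in> {(x, y, z), (y, z, x), (z, x, y)}"
        using px pa t(1) by auto
    next
      fix t assume "t \<in> {(x, y, z), (y, z, x), (z, x, y)}"
      moreover have "(y, z, x) \<in> triples n" "(z, x, y) \<in> triples n"
        using xyz triples_rotate by blast+
      moreover have "cycle_of_list [y, z, x] = p" "cycle_of_list [z, x, y] = p"
        unfolding p using d cycle_of_list_3_rotate[of x y z] cycle_of_list_3_rotate[of z x y] by auto
      ultimately show "t \<in> {t \<in> triples n. ?c t = p}"
        using xyz p by (auto simp del: cycle_of_list.simps)
    qed
    then show ?thesis using d by auto
  qed
  have "(\<Sum>(j3, j2, j1)\<in>triples n. F (cycle_of_list [j3, j2, j1])) = (\<Sum>t\<in>triples n. F (?c t))"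
    by (intro sum.cong) auto
  also have "\<dots> = (\<Sum>p\<in>three_cycles n. \<Sum>t | t \<in> triples n \<and> ?c t = p. F (?c t))"
    unfolding im[symmetric] by (rule sum.image_gen[OF finite_triples])
  also have "\<dots> = (\<Sum>p\<in>three_cycles n. 3 * F p)"
  proof (rule sum.cong[OF refl])
    fix p assume "p \<in> three_cycles n"
    have "(\<Sum>t | t \<in> triples n \<and> ?c t = p. F (?c t)) = (\<Sum>t | t \<in> triples n \<and> ?c t = p. F p)"
      by (rule sum.cong) auto
    also have "\<dots> = 3 * F p" using card[OF \<open>p \<in> _\<close>] by simp
    finally show "(\<Sum>t | t \<in> triples n \<and> ?c t = p. F (?c t)) = 3 * F p" .
  qed
  finally show ?thesis by (simp add: sum_distrib_left)
qed

section \<open>Linearity and the passage to finite sums\<close>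

lemma Phi_eq:
  "Phi n g = (\<Sum>\<sigma>\<in>Poly_Mapping.keys g.
     pconst (Poly_Mapping.lookup g \<sigma>) * orbits_poly (orbit \<sigma> ` {1..n}))"
  unfolding Phi_def cycle_type_def orbits_poly_def prod_unfold_prod_mset
  by (simp add: multiset.map_comp o_def)

lemma Phi_add: "Phi n (f + g) = Phi n f + Phi n g"
  unfolding Phi_eq by (rule setsum_keys_plus_distrib) (simp_all add: pconst_add distrib_right)

lemma Phi_sum: "Phi n (sum h A) = (\<Sum>x\<in>A. Phi n (h x))"
  by (rule additive_sum) (rule Phi_add)

lemma Phi_single: "Phi n (Poly_Mapping.single \<sigma> a) = pconst a * orbits_poly (orbit \<sigma> ` {1..n})"
  by (cases "a = 0") (simp_all add: Phi_eq)

lemma alg_mult_add_left: "alg_mult (f + f') g = alg_mult f g + alg_mult f' g"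
  unfolding alg_mult_def
  by (rule setsum_keys_plus_distrib) (simp_all add: distrib_right single_add sum.distrib)

lemma alg_mult_sum_left: "alg_mult (sum h A) g = (\<Sum>x\<in>A. alg_mult (h x) g)"
  by (rule additive_sum) (rule alg_mult_add_left)

lemma Phi_single_mult:
  "Phi n (alg_mult (Poly_Mapping.single c 1) g) = (\<Sum>\<sigma>\<in>Poly_Mapping.keys g.
     pconst (Poly_Mapping.lookup g \<sigma>) * orbits_poly (orbit (c \<circ> \<sigma>) ` {1..n}))"
  by (simp add: alg_mult_def Phi_sum Phi_single)

lemma Delta3_term_add: "Delta3_term a b c (f + g) = Delta3_term a b c f + Delta3_term a b c g"
  by (simp only: Delta3_term_def pdiff_add distrib_left) (simp only: ac_simps)

lemma Delta3_term_pconst_mult: "Delta3_term a b c (pconst k * f) = pconst k * Delta3_term a b c f"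
  by (simp only: Delta3_term_def pdiff_pconst_mult distrib_left mult.left_commute[of _ "pconst k"])

text \<open>By finiteness of the support, a sum over a box suffices. The parameter \<open>m\<close>
  enlarges the box; it is later taken to be \<open>n\<close>, so that the index range contains all
  cycle lengths.\<close>

lemma Delta3_eq_sum:
  obtains N where "m \<le> N"
    and "Delta3 f = pconst (1/3) * (\<Sum>i1=1..N. \<Sum>i2=1..N. \<Sum>i3=1..N. Delta3_term i1 i2 i3 f)"
proof -
  let ?S = "{(i1, i2, i3). Delta3_term i1 i2 i3 f \<noteq> 0 \<and> 1 \<le> i1 \<and> 1 \<le> i2 \<and> 1 \<le> i3}"
  let ?g = "\<lambda>(i1, i2, i3). Delta3_term i1 i2 i3 f when (1 \<le> i1 \<and> 1 \<le> i2 \<and> 1 \<le> i3)"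
  let ?s = "\<lambda>(i1, i2, i3). i1 + i2 + i3"
  have fin: "finite (?s ` ?S)" using finite_Delta3_support[of f] by (rule finite_imageI)
  \<comment> \<open>The index sums bound the single indices; \<open>0\<close> is inserted for the
    case of an empty support.\<close>
  define N where "N = max m (Max (insert 0 (?s ` ?S)))"
  have bound: "?s t \<le> N" if "t \<in> ?S" for t
    unfolding N_def using that fin by (intro max.coboundedI2 Max_ge) auto
  have "{t. ?g t \<noteq> 0} \<subseteq> {1..N} \<times> {1..N} \<times> {1..N}"
  proof
    fix t assume "t \<in> {t. ?g t \<noteq> 0}"
    then have "t \<in> ?S" by (auto simp: when_def split: if_splits prod.splits)
    then show "t \<in> {1..N} \<times> {1..N} \<times> {1..N}" using bound[of t] by auto
  qed
  then have "Sum_any ?g = sum ?g ({1..N} \<times> {1..N} \<times> {1..N})"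
    by (intro Sum_any.expand_superset) auto
  also have "\<dots> = (\<Sum>i1=1..N. \<Sum>i2=1..N. \<Sum>i3=1..N. Delta3_term i1 i2 i3 f)"
    unfolding sum.cartesian_product by (intro sum.cong) auto
  finally show ?thesis
    by (intro that[of N]) (simp_all add: N_def Delta3_def)
qed

lemma Phi_K3bar_mult:
  "Phi n (K3bar_mult n g) = (\<Sum>(j3, j2, j1)\<in>triples n.
    Phi n (alg_mult (Poly_Mapping.single (cycle_of_list [j3, j2, j1]) 1) g))"
  unfolding K3bar_mult_def triples_def[symmetric] Phi_sum
  by (intro sum.cong) (auto simp del: cycle_of_list.simps)

theorem theorem4p24:
  fixes n :: nat and g :: perm_alg
  assumes "n \<ge> 3" and "g \<in> group_alg n"
  shows "3 * Phi n (alg_mult (K3 n) g) = Phi n (K3bar_mult n g)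
    \<and> Phi n (K3bar_mult n g) = 3 * Delta3 (Phi n g)"
proof
  show "3 * Phi n (alg_mult (K3 n) g) = Phi n (K3bar_mult n g)"
    unfolding Phi_K3bar_mult sum_3cycles[where F = "\<lambda>c. Phi n (alg_mult (Poly_Mapping.single c 1) g)"]
    by (simp only: K3_def alg_mult_sum_left Phi_sum)
next
  let ?a = "\<lambda>\<sigma>. pconst (Poly_Mapping.lookup g \<sigma>)"
  let ?P = "\<lambda>\<sigma>. orbits_poly (orbit \<sigma> ` {1..n})"
  \<comment> \<open>The bound is chosen for \<open>Phi n g\<close> as a whole. The identity for a
    single permutation holds for every \<open>N\<close> with \<open>n \<le> N\<close>, so the same
    box serves all permutations in the support of \<open>g\<close>.\<close>
  obtain N where N: "n \<le> N" and D: "Delta3 (Phi n g) =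
      pconst (1/3) * (\<Sum>i1=1..N. \<Sum>i2=1..N. \<Sum>i3=1..N. Delta3_term i1 i2 i3 (Phi n g))"
    by (rule Delta3_eq_sum)
  have basis: "(\<Sum>i1=1..N. \<Sum>i2=1..N. \<Sum>i3=1..N. Delta3_term i1 i2 i3 (?P \<sigma>)) =
      (\<Sum>(j3, j2, j1)\<in>triples n. ?P (cycle_of_list [j3, j2, j1] \<circ> \<sigma>))"
    if "\<sigma> \<in> Poly_Mapping.keys g" for \<sigma>
  proof -
    interpret perm_upto n \<sigma>
      using that assms(2) by unfold_locales (auto simp: group_alg_def sym_group_def)
    show ?thesis
      using sum_Delta3_term_rest[OF N] unfolding rest_def cycle3_poly_def Diff_empty .
  qed
  have "(3 :: cpoly) = pconst 3"
    by (simp add: pconst_def)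
  then have "3 * pconst (1/3) = 1"
    by (simp only: pconst_mult) (simp add: pconst_def)
  then have "3 * Delta3 (Phi n g) = (\<Sum>i1=1..N. \<Sum>i2=1..N. \<Sum>i3=1..N. Delta3_term i1 i2 i3 (Phi n g))"
    by (simp only: D mult.assoc[symmetric] mult_1_left)
  also have "\<dots> = (\<Sum>i1=1..N. \<Sum>i2=1..N. \<Sum>i3=1..N. \<Sum>\<sigma>\<in>Poly_Mapping.keys g. ?a \<sigma> * Delta3_term i1 i2 i3 (?P \<sigma>))"
    by (simp only: Phi_eq additive_sum[of "Delta3_term _ _ _", OF Delta3_term_add] Delta3_term_pconst_mult)
  also have "\<dots> = (\<Sum>\<sigma>\<in>Poly_Mapping.keys g. ?a \<sigma> * (\<Sum>i1=1..N. \<Sum>i2=1..N. \<Sum>i3=1..N. Delta3_term i1 i2 i3 (?P \<sigma>)))"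
    unfolding sum_distrib_left by (simp only: sum.swap[of _ "Poly_Mapping.keys g"])
  also have "\<dots> = (\<Sum>\<sigma>\<in>Poly_Mapping.keys g. \<Sum>(j3, j2, j1)\<in>triples n. ?a \<sigma> * ?P (cycle_of_list [j3, j2, j1] \<circ> \<sigma>))"
    by (intro sum.cong refl) (simp only: basis sum_distrib_left case_prod_unfold)
  also have "\<dots> = Phi n (K3bar_mult n g)"
    unfolding Phi_K3bar_mult Phi_single_mult case_prod_unfold by (rule sum.swap)
  finally show "Phi n (K3bar_mult n g) = 3 * Delta3 (Phi n g)" ..
qed

end
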